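(* Let $d\ge 1$ and let $\{(X_i^{(1)}, X_i^{(2)}, \ldots, X_i^{(d)}),\ i=1,2,\ldots\}$ be a sequence of random vectors in $\mathbb{R}^d$, defined on a common probability space, such that for each $j$ $(1\le j\le d)$ the sequence $X_1^{(j)},X_2^{(j)},\ldots$ consists of i.i.d. random variables with distribution function $F_j$ (no assumption is made on the joint dependence between different coordinates). Let $\phi:\mathbb{R}^d\to\mathbb{R}$ be measurable, and let $\psi$ and $\gamma$ be the associated functions defined in the context. Suppose that (i) $\psi$ is continuous at every point $(u,\ldots,u)$ with $0<u<1$ (the function $\psi$ need not be bounded); (ii) there exist $K$ and $c_0>0$ such that $$|\psi(x_1,\ldots,x_d)|\le K\Bigl(1+\sum_{j=1}^d|\gamma(x_j)|\Bigr)\quad\text{for all }(x_1,\ldots,x_d)\in(0,c_0)^d\cup(1-c_0,1)^d;$$ (iii) $F_j$ is continuous for $1\le j\le d$; (iv) $\gamma$ is Riemann integrable on $(0,1)$. Then, as $n\to\infty$, $$\frac1n\sum_{i=1}^n\phi\bigl(X_{n:i}^{(1)},\ldots,X_{n:i}^{(d)}\bigr)\longrightarrow\bar\gamma\quad\text{almost surely},\qquad\text{where }\bar\gamma=\int_0^1\gamma(y)\,dy.$$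
   Context: For each $j$ and $n$, $X_{n:i}^{(j)}$ denotes the $i$th order statistic (the $i$th smallest value) of $X_1^{(j)},\ldots,X_n^{(j)}$. For a distribution function $F$ and $0<t<1$, $F^{-1}(t)=\inf\{x: F(x)\ge t\}$. For $0<x,x_1,\ldots,x_d<1$ define $$\psi(x_1,\ldots,x_d)=\phi\bigl(F_1^{-1}(x_1),\ldots,F_d^{-1}(x_d)\bigr),\qquad \gamma(x)=\psi(x,x,\ldots,x).$$ *)

theory Defs
  imports "HOL-Probability.Probability"
begin

definition quantile :: "(real \<Rightarrow> real) \<Rightarrow> real \<Rightarrow> real" where
  "quantile F t = Inf {x. t \<le> F x}"

text \<open>Only the values of \<open>psi\<close> on the open unit cube, and of \<open>gamma\<close> on the open
  unit interval, are meaningful; elsewhere \<open>quantile\<close> may be the infimum of an empty or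
  unbounded set.\<close>

definition psi :: "(real ^ 'd \<Rightarrow> real) \<Rightarrow> ('d \<Rightarrow> real \<Rightarrow> real) \<Rightarrow> real ^ 'd \<Rightarrow> real" where
  "psi \<phi> F x = \<phi> (\<chi> j. quantile (F j) (x $ j))"

definition gamma :: "(real ^ 'd \<Rightarrow> real) \<Rightarrow> ('d \<Rightarrow> real \<Rightarrow> real) \<Rightarrow> real \<Rightarrow> real" where
  "gamma \<phi> F t = psi \<phi> F (\<chi> j. t)"

text \<open>\<open>order_stat x n i\<close> is the \<open>i\<close>-th smallest of \<open>x 1, \<dots>, x n\<close>, counted with
  multiplicity, for \<open>1 \<le> i \<le> n\<close>.\<close>

definition order_stat :: "(nat \<Rightarrow> real) \<Rightarrow> nat \<Rightarrow> nat \<Rightarrow> real" where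
  "order_stat x n i = sort (map x [1..<Suc n]) ! (i - 1)"

text \<open>The Riemann integral over a compact interval: Riemann sums over tagged divisions
  converge as the mesh tends to 0 (unlike \<open>has_integral\<close>, where the gauge may
  depend on the tag). Each \<open>k\<close> in a tagged division is a compact interval, so
  \<open>measure lborel k\<close> is its length.\<close>

definition has_riemann_integral :: "(real \<Rightarrow> real) \<Rightarrow> real \<Rightarrow> real \<Rightarrow> real \<Rightarrow> bool" where
  "has_riemann_integral f I a b \<longleftrightarrow>
     (\<forall>e>0. \<exists>\<delta>>0. \<forall>p. p tagged_division_of {a..b} \<and> (\<forall>(x, k)\<in>p. measure lborel k < \<delta>) \<longrightarrow>
        \<bar>(\<Sum>(x, k)\<in>p. measure lborel k * f x) - I\<bar> < e)"

definition riemann_integral :: "(real \<Rightarrow> real) \<Rightarrow> real \<Rightarrow> real \<Rightarrow> real" where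
  "riemann_integral f a b = (THE I. has_riemann_integral f I a b)"

text \<open>The Riemann integral over an open interval of a possibly unbounded function, in the
  improper sense: the two endpoints are approached independently.\<close>

definition has_improper_riemann_integral :: "(real \<Rightarrow> real) \<Rightarrow> real \<Rightarrow> real \<Rightarrow> real \<Rightarrow> bool" where
  "has_improper_riemann_integral f I a b \<longleftrightarrow>
     (\<forall>c d. a < c \<and> c < d \<and> d < b \<longrightarrow> (\<exists>J. has_riemann_integral f J c d)) \<and>
     ((\<lambda>(c, d). riemann_integral f c d) \<longlongrightarrow> I) (at_right a \<times>\<^sub>F at_left b)"

definition improper_riemann_integral :: "(real \<Rightarrow> real) \<Rightarrow> real \<Rightarrow> real \<Rightarrow> real" where
  "improper_riemann_integral f a b = (THE I. has_improper_riemann_integral f I a b)"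

text \<open>A Riemann integrable function has a Riemann integrable absolute value. For unbounded
  functions this does not follow from convergence of the improper integral, and is required
  explicitly: if \<open>\<integral>\<bar>f\<bar>\<close> diverges and \<open>U\<^sub>i\<close> are
  independent and uniform on \<open>(0,1)\<close>, then the averages of \<open>f U\<^sub>i\<close> almost surely diverge.\<close>

definition riemann_integrable_open :: "(real \<Rightarrow> real) \<Rightarrow> real \<Rightarrow> real \<Rightarrow> bool" where
  "riemann_integrable_open f a b \<longleftrightarrow>
     (\<exists>I. has_improper_riemann_integral f I a b) \<and>
     (\<exists>I. has_improper_riemann_integral (\<lambda>x. \<bar>f x\<bar>) I a b)"

lemma has_riemann_integral_imp_has_integral:
  assumes "has_riemann_integral f I a b"
  shows "(f has_integral I) {a..b}"
  unfolding has_integral_real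
proof (intro allI impI)
  fix e :: real assume "e > 0"
  with assms[unfolded has_riemann_integral_def, rule_format, of e]
  obtain \<delta> where \<delta>: "\<delta> > 0" and sums: "\<forall>p. p tagged_division_of {a..b} \<and>
      (\<forall>(x, k)\<in>p. measure lborel k < \<delta>) \<longrightarrow> \<bar>(\<Sum>(x, k)\<in>p. measure lborel k * f x) - I\<bar> < e"
    by blast
  show "\<exists>\<gamma>. gauge \<gamma> \<and> (\<forall>\<D>. \<D> tagged_division_of {a..b} \<and> \<gamma> fine \<D> \<longrightarrow>
      norm ((\<Sum>(x, k)\<in>\<D>. measure lborel k *\<^sub>R f x) - I) < e)"
  proof (intro exI conjI allI impI)
    show "gauge (\<lambda>x. ball x (\<delta> / 2))"
      using \<delta> by (intro gauge_ball) auto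
    fix p assume p: "p tagged_division_of {a..b} \<and> (\<lambda>x. ball x (\<delta> / 2)) fine p"
    then have td: "p tagged_division_of {a..b}" and fine: "(\<lambda>x. ball x (\<delta> / 2)) fine p"
      by simp_all
    have "measure lborel k < \<delta>" if xk: "(x, k) \<in> p" for x k
    proof -
      obtain u v where k: "k = cbox u v"
        using tagged_division_ofD(4)[OF td xk] by (elim exE)
      have "x \<in> k" "k \<subseteq> ball x (\<delta> / 2)"
        using tagged_division_ofD(2)[OF td xk] fineD[OF fine xk] by simp_all
      then have uv: "u \<le> v" "dist x u < \<delta> / 2" "dist x v < \<delta> / 2"
        unfolding k by (auto simp: subset_iff simp del: dist_real_def)
      have "v - u \<le> dist x u + dist x v"
        by (simp add: dist_real_def)
      also have "\<dots> < \<delta>"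
        using uv by simp
      finally show ?thesis unfolding k using uv by simp
    qed
    then have "\<forall>(x, k)\<in>p. measure lborel k < \<delta>" by auto
    then show "norm ((\<Sum>(x, k)\<in>p. measure lborel k *\<^sub>R f x) - I) < e"
      using sums[rule_format, of p] td by (simp add: split_beta)
  qed
qed

lemma riemann_integral_eq:
  assumes "has_riemann_integral f I a b"
  shows "riemann_integral f a b = I"
  unfolding riemann_integral_def using assms
  by (intro the_equality) (auto dest!: has_riemann_integral_imp_has_integral intro: has_integral_unique)

lemma improper_riemann_integral_eq:
  assumes "has_improper_riemann_integral f I a b"
  shows "improper_riemann_integral f a b = I"
proof -
  have "at_right a \<times>\<^sub>F at_left b \<noteq> bot"
    by (simp add: prod_filter_eq_bot)
  then show ?thesis
    unfolding improper_riemann_integral_def using assms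
    by (intro the_equality) (auto simp: has_improper_riemann_integral_def intro: tendsto_unique)
qed

end

theory Submission
  imports Defs
begin

text \<open>The probability integral transform reduces the theorem to uniform variables. As \<open>F\<^sub>j\<close> is
  continuous, the variables \<open>U\<^sub>k = F\<^sub>j (X\<^sub>k)\<close> are uniform on \<open>(0, 1)\<close> for every
  coordinate \<open>j\<close>, and almost surely the quantile function takes them back to \<open>X\<^sub>k\<close>. Order
  statistics commute with monotone functions, so the average in question is the average of
  \<open>\<psi>\<close> over the points whose coordinates are the \<open>i\<close>-th order statistics of the uniform
  samples.

  These points are close to the diagonal: by the law of large numbers for the empirical
  distribution functions, the \<open>i\<close>-th of \<open>n\<close> uniform order statistics is close to
  \<open>i / n\<close>, uniformly in \<open>i\<close> (\<open>order_stat_uniformly_near\<close>). This is where the joint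
  distribution of the coordinates drops out, since an almost sure limit can be taken for each
  coordinate separately. If \<open>\<psi>\<close> were uniformly continuous along the diagonal, the average
  would now be a Riemann sum of \<open>\<gamma>\<close> up to a small error, and that is what happens for
  \<open>i / n\<close> in a compact subinterval of \<open>(0, 1)\<close>.

  Near the ends of the unit interval \<open>\<psi>\<close> may be unbounded, and one has to show that the
  terms with \<open>i / n\<close> near \<open>0\<close> or \<open>1\<close> contribute little. The growth condition
  estimates them by the values of \<open>\<bar>\<gamma>\<bar>\<close> at the single coordinates. The sum of a function of one
  coordinate over the order statistics is its sum over the sample, so the contribution is at most a
  constant times averages of \<open>(1 + \<bar>\<gamma>\<bar>) * indicator {points near the ends}\<close> over uniform
  samples. Their expectation is small because \<open>\<bar>\<gamma>\<bar>\<close> is integrable, and a law of large numbers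
  transfers this to the averages. An upper bound up to a constant factor suffices here, which is
  \<open>iid_average_eventually_bounded\<close>. The lemma \<open>average_order_stats_tendsto\<close> combines the
  two regimes for a fixed outcome.\<close>

section \<open>Averages of independent variables\<close>

lemma (in prob_space) variance_sum_indep:
  fixes Y :: "'i \<Rightarrow> 'a \<Rightarrow> real"
  assumes fin: "finite I"
    and indep: "indep_vars (\<lambda>_. borel) Y I"
    and sq: "\<And>i. i \<in> I \<Longrightarrow> integrable M (\<lambda>\<omega>. (Y i \<omega>)\<^sup>2)"
  shows "integrable M (\<lambda>\<omega>. (\<Sum>i\<in>I. Y i \<omega>)\<^sup>2)" (is ?int)
    and "variance (\<lambda>\<omega>. \<Sum>i\<in>I. Y i \<omega>) = (\<Sum>i\<in>I. variance (Y i))" (is ?var)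
proof -
  have rv: "random_variable borel (Y i)" if "i \<in> I" for i
    using indep that unfolding indep_vars_def by blast
  have int: "integrable M (Y i)" if "i \<in> I" for i
    using square_integrable_imp_integrable[OF rv sq] that by blast
  define Z where "Z i \<omega> = Y i \<omega> - expectation (Y i)" for i \<omega>
  have indepZ: "indep_vars (\<lambda>_. borel) Z I"
    unfolding Z_def by (rule indep_vars_compose2[OF indep]) auto
  have intZ: "integrable M (Z i)" and meanZ: "expectation (Z i) = 0"
    and sqZ: "integrable M (\<lambda>\<omega>. Z i \<omega> * Z i \<omega>)" if "i \<in> I" for i
  proof -
    show "integrable M (Z i)" "expectation (Z i) = 0"
      unfolding Z_def using int[OF that] by (auto simp: prob_space)
    have "(\<lambda>\<omega>. Z i \<omega> * Z i \<omega>) = (\<lambda>\<omega>. (Y i \<omega>)\<^sup>2 - 2 * expectation (Y i) * Y i \<omega> + (expectation (Y i))\<^sup>2)"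
      by (auto simp: Z_def power2_eq_square algebra_simps)
    then show "integrable M (\<lambda>\<omega>. Z i \<omega> * Z i \<omega>)"
      using sq[OF that] int[OF that] by simp
  qed
  have prodZ: "integrable M (\<lambda>\<omega>. Z i \<omega> * Z j \<omega>)"
    "expectation (\<lambda>\<omega>. Z i \<omega> * Z j \<omega>) = (if i = j then variance (Y i) else 0)"
    if ij: "i \<in> I" "j \<in> I" for i j
  proof -
    have "integrable M (\<lambda>\<omega>. Z i \<omega> * Z j \<omega>) \<and>
      expectation (\<lambda>\<omega>. Z i \<omega> * Z j \<omega>) = (if i = j then variance (Y i) else 0)"
    proof (cases "i = j")
      case True
      then show ?thesis using sqZ[OF ij(1)] by (simp add: Z_def power2_eq_square)
    next
      case False
      have sub: "indep_vars (\<lambda>_. borel) Z {i, j}"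
        using indep_vars_subset[OF indepZ] ij by auto
      have "integrable M (\<lambda>\<omega>. \<Prod>k\<in>{i, j}. Z k \<omega>)"
        by (rule indep_vars_integrable[OF _ sub]) (use ij intZ in auto)
      moreover have "expectation (\<lambda>\<omega>. \<Prod>k\<in>{i, j}. Z k \<omega>) = (\<Prod>k\<in>{i, j}. expectation (Z k))"
        by (rule indep_vars_lebesgue_integral[OF _ sub]) (use ij intZ in auto)
      ultimately show ?thesis using False meanZ ij by simp
    qed
    then show "integrable M (\<lambda>\<omega>. Z i \<omega> * Z j \<omega>)"
      "expectation (\<lambda>\<omega>. Z i \<omega> * Z j \<omega>) = (if i = j then variance (Y i) else 0)" by blast+
  qed
  have center: "(\<Sum>i\<in>I. Y i \<omega>) - expectation (\<lambda>\<omega>. \<Sum>i\<in>I. Y i \<omega>) = (\<Sum>i\<in>I. Z i \<omega>)" for \<omega>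
    unfolding Z_def using int by (simp add: sum_subtractf Bochner_Integration.integral_sum)
  have expand: "(\<Sum>i\<in>I. Z i \<omega>)\<^sup>2 = (\<Sum>i\<in>I. \<Sum>j\<in>I. Z i \<omega> * Z j \<omega>)" for \<omega>
    by (simp add: power2_eq_square sum_product)
  have "variance (\<lambda>\<omega>. \<Sum>i\<in>I. Y i \<omega>) = expectation (\<lambda>\<omega>. \<Sum>i\<in>I. \<Sum>j\<in>I. Z i \<omega> * Z j \<omega>)"
    unfolding center expand ..
  also have "\<dots> = (\<Sum>i\<in>I. \<Sum>j\<in>I. if i = j then variance (Y i) else 0)"
    using prodZ by (simp add: Bochner_Integration.integral_sum)
  also have "\<dots> = (\<Sum>i\<in>I. variance (Y i))"
    using fin by simp
  finally show ?var .
  define m where "m = expectation (\<lambda>\<omega>. \<Sum>i\<in>I. Y i \<omega>)"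
  have "(\<lambda>\<omega>. (\<Sum>i\<in>I. Y i \<omega>)\<^sup>2) = (\<lambda>\<omega>. (\<Sum>i\<in>I. \<Sum>j\<in>I. Z i \<omega> * Z j \<omega>) + 2 * m * (\<Sum>i\<in>I. Z i \<omega>) + m\<^sup>2)"
  proof
    fix \<omega>
    have "(\<Sum>i\<in>I. Y i \<omega>) = (\<Sum>i\<in>I. Z i \<omega>) + m"
      using center[of \<omega>] by (simp add: m_def)
    then show "(\<Sum>i\<in>I. Y i \<omega>)\<^sup>2 = (\<Sum>i\<in>I. \<Sum>j\<in>I. Z i \<omega> * Z j \<omega>) + 2 * m * (\<Sum>i\<in>I. Z i \<omega>) + m\<^sup>2"
      by (simp add: expand[symmetric] power2_eq_square algebra_simps)
  qed
  then show ?int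
    using prodZ(1) intZ by (auto intro!: Bochner_Integration.integrable_add Bochner_Integration.integrable_sum)
qed

text \<open>The levels \<open>2 ^ k\<close> below \<open>z\<close> form a geometric progression, so their sum is less than
  twice the largest of them.\<close>

lemma sum_dyadic_levels_below:
  fixes z :: real
  assumes "0 \<le> z"
  shows "(\<Sum>k<K. 2^k * indicator {2^k<..} z) \<le> 2 * z"
proof (induction K)
  case (Suc K)
  show ?case
  proof (cases "2^K < z")
    case True
    have "(\<Sum>k<Suc K. 2^k * indicator {2^k<..} z) \<le> (\<Sum>k<Suc K. (2::real)^k)"
      by (intro sum_mono) (auto simp: indicator_def)
    also have "\<dots> = 2^Suc K - 1"
      by (induction K) auto
    finally show ?thesis using True by simp
  qed (use Suc in simp)
qed (use assms in simp)

text \<open>Only the levels \<open>2 ^ k \<ge> z\<close> contribute, the first of them at most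
  \<open>z\<^sup>2 / z = z\<close>, and the contributions halve from one level to the next.\<close>

lemma sum_dyadic_truncated_squares:
  fixes z :: real
  assumes "0 \<le> z"
  shows "(\<Sum>k<K. (z * indicator {..2^k} z)\<^sup>2 / 2^k) \<le> 2 * z"
proof -
  \<comment> \<open>The subtracted term bounds the sum of the levels from \<open>K\<close> on; with it the bound
    passes from \<open>K\<close> to \<open>Suc K\<close>.\<close>
  have "(\<Sum>k<K. (z * indicator {..2^k} z)\<^sup>2 / 2^k) \<le> max 0 (2 * z - 2 * z\<^sup>2 / 2^K)"
  proof (induction K)
    case (Suc K)
    show ?case
    proof (cases "z \<le> 2^K")
      case True
      have "z\<^sup>2 / 2^K \<le> z"
        using True assms by (simp add: power2_eq_square field_simps mult_left_mono)
      then have "max 0 (2 * z - 2 * z\<^sup>2 / 2^K) + z\<^sup>2 / 2^K \<le> 2 * z - z\<^sup>2 / 2^K"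
        by auto
      then show ?thesis using Suc True by simp
    next
      case False
      then have "z * 2^K \<le> z * z"
        using assms by (intro mult_left_mono) auto
      then have "2 * z - 2 * z\<^sup>2 / 2^K \<le> 0"
        by (simp add: power2_eq_square field_simps)
      then show ?thesis using Suc False by simp
    qed
  qed simp
  also have "\<dots> \<le> 2 * z" using assms by simp
  finally show ?thesis .
qed

text \<open>An integrable variable passes the dyadic level \<open>2 ^ k\<close> so rarely that even the union of
  \<open>2 ^ k\<close> such events is summable over \<open>k\<close>, and its truncation at \<open>2 ^ k\<close> has second
  moment small enough for Chebyshev's inequality at the times \<open>2 ^ k\<close>. Both statements are the
  pointwise bounds above, integrated.\<close>

lemma (in finite_measure)
  fixes Z :: "'a \<Rightarrow> real"
  assumes int: "integrable M Z" and nonneg: "AE x in M. 0 \<le> Z x"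
  shows summable_dyadic_tails: "summable (\<lambda>k. 2^k * measure M {x\<in>space M. 2^k < Z x})" (is ?tails)
    and summable_dyadic_truncated_squares:
      "summable (\<lambda>k. (\<integral>x. (Z x * indicator {..2^k} (Z x))\<^sup>2 \<partial>M) / 2^k)" (is ?squares)
proof -
  have [measurable]: "Z \<in> borel_measurable M" using int by auto
  have eq: "2^k * measure M {x\<in>space M. 2^k < Z x} = (\<integral>x. 2^k * indicator {2^k<..} (Z x) \<partial>M)" for k :: nat
  proof -
    have "(\<integral>x. indicator {2^k<..} (Z x) \<partial>M) = (\<integral>x. indicator {x\<in>space M. 2^k < Z x} x \<partial>M :: real)"
      by (intro Bochner_Integration.integral_cong) (auto simp: indicator_def)
    then show ?thesis by simp
  qed
  have int1: "integrable M (\<lambda>x. 2^k * indicator {2^k<..} (Z x) :: real)" for k :: nat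
    by (rule integrable_const_bound[of _ "2^k"]) (auto simp: indicator_def)
  show ?tails
  proof (rule summableI_nonneg_bounded)
    fix K
    have "(\<Sum>k<K. 2^k * measure M {x\<in>space M. 2^k < Z x}) = (\<integral>x. (\<Sum>k<K. 2^k * indicator {2^k<..} (Z x)) \<partial>M)"
      unfolding eq by (rule Bochner_Integration.integral_sum[symmetric]) (rule int1)
    also have "\<dots> \<le> (\<integral>x. 2 * Z x \<partial>M)"
    proof (rule integral_mono_AE)
      show "AE x in M. (\<Sum>k<K. 2^k * indicator {2^k<..} (Z x)) \<le> 2 * Z x"
        using nonneg by eventually_elim (rule sum_dyadic_levels_below)
    qed (rule Bochner_Integration.integrable_sum int1 integrable_mult_right int)+
    finally show "(\<Sum>k<K. 2^k * measure M {x\<in>space M. 2^k < Z x}) \<le> (\<integral>x. 2 * Z x \<partial>M)" .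
  qed auto
  have int2: "integrable M (\<lambda>x. (Z x * indicator {..2^k} (Z x))\<^sup>2 / 2^k)" for k :: nat
  proof (rule integrable_const_bound[of _ "(2^k)\<^sup>2 / 2^k"])
    show "AE x in M. norm ((Z x * indicator {..2^k} (Z x))\<^sup>2 / 2^k) \<le> (2^k)\<^sup>2 / 2^k"
      using nonneg
    proof eventually_elim
      case (elim x)
      have "(Z x * indicator {..2^k} (Z x))\<^sup>2 \<le> (2^k)\<^sup>2"
        using elim by (intro power_mono) (auto simp: indicator_def)
      then show ?case by (simp add: divide_right_mono)
    qed
  qed measurable
  show ?squares
  proof (rule summableI_nonneg_bounded)
    fix K
    have "(\<Sum>k<K. (\<integral>x. (Z x * indicator {..2^k} (Z x))\<^sup>2 \<partial>M) / 2^k) =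
        (\<Sum>k<K. (\<integral>x. (Z x * indicator {..2^k} (Z x))\<^sup>2 / 2^k \<partial>M))"
      by simp
    also have "\<dots> = (\<integral>x. (\<Sum>k<K. (Z x * indicator {..2^k} (Z x))\<^sup>2 / 2^k) \<partial>M)"
      by (rule Bochner_Integration.integral_sum[symmetric]) (rule int2)
    also have "\<dots> \<le> (\<integral>x. 2 * Z x \<partial>M)"
    proof (rule integral_mono_AE)
      show "AE x in M. (\<Sum>k<K. (Z x * indicator {..2^k} (Z x))\<^sup>2 / 2^k) \<le> 2 * Z x"
        using nonneg by eventually_elim (rule sum_dyadic_truncated_squares)
    qed (rule Bochner_Integration.integrable_sum int2 integrable_mult_right int)+
    finally show "(\<Sum>k<K. (\<integral>x. (Z x * indicator {..2^k} (Z x))\<^sup>2 \<partial>M) / 2^k) \<le> (\<integral>x. 2 * Z x \<partial>M)" .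
  qed auto
qed

text \<open>A one-sided law of large numbers for nonnegative integrable variables, with the constant
  \<open>2\<close> in front of the mean. Losing this constant makes the proof short: it is enough to control
  the partial sums at the times \<open>2 ^ k\<close>, because the sum up to any \<open>n\<close> in between is at
  most the sum up to the next power of two, which is at most \<open>2 * n\<close>. At time \<open>2 ^ k\<close>
  the variables are truncated at \<open>2 ^ k\<close>; truncation changes the sum with summable
  probability, and, by Chebyshev's inequality, the probability that the truncated sum
  exceeds its mean by \<open>\<eta> * 2 ^ k\<close> is summable too. The Borel-Cantelli lemma disposes of both events.

  The constant is harmless wherever the mean can be made arbitrarily small.\<close>

lemma (in prob_space) iid_average_eventually_bounded:
  fixes Z :: "nat \<Rightarrow> 'a \<Rightarrow> real"
  assumes indep: "indep_vars (\<lambda>_. borel) Z {1..}"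
    and law: "\<And>i. i \<ge> 1 \<Longrightarrow> distr M borel (Z i) = D"
    and nonneg: "\<And>i \<omega>. 0 \<le> Z i \<omega>"
    and int: "integrable D (\<lambda>x. x)"
    and c: "c > 0"
  shows "AE \<omega> in M. \<forall>\<^sub>F n in sequentially. (\<Sum>i=1..n. Z i \<omega>) \<le> real n * (2 * (\<integral>x. x \<partial>D) + c)"
proof -
  define \<mu> where "\<mu> = (\<integral>x. x \<partial>D)"
  define \<eta> where "\<eta> = c / 2"
  have \<eta>: "\<eta> > 0" using c by (simp add: \<eta>_def)
  define g where "g k x = x * indicator {..2^k} x" for k :: nat and x :: real
  define T where "T k \<omega> = (\<Sum>i\<in>{1..2^k}. g k (Z i \<omega>))" for k :: nat and \<omega>
  have rvZ[measurable]: "random_variable borel (Z i)" if "1 \<le> i" for i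
    using indep that unfolding indep_vars_def by blast
  have [measurable]: "g k \<in> borel_measurable borel" for k
    unfolding g_def by measurable
  have D: "D = distr M borel (Z 1)" using law[of 1] by simp
  interpret D: prob_space D unfolding D by (rule prob_space_distr) simp
  have sets_D[simp, measurable_cong]: "sets D = sets borel" and space_D[simp]: "space D = UNIV"
    by (simp_all add: D)
  have D_nonneg: "AE x in D. 0 \<le> x"
    unfolding D using nonneg by (subst AE_distr_iff) auto
  have law_int: "expectation (\<lambda>\<omega>. h (Z i \<omega>)) = (\<integral>x. h x \<partial>D)"
    if "i \<ge> 1" "h \<in> borel_measurable borel" for i and h :: "real \<Rightarrow> real"
    unfolding law[OF that(1), symmetric] by (rule integral_distr[symmetric]) (use that rvZ in auto)
  have g_bound: "\<bar>g k (Z i \<omega>)\<bar> \<le> 2^k" "0 \<le> g k (Z i \<omega>)" for k i \<omega>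
    using nonneg[of i \<omega>] by (auto simp: g_def indicator_def)
  have g_sq: "integrable M (\<lambda>\<omega>. (g k (Z i \<omega>))\<^sup>2)" if "i \<ge> 1" for i k
  proof (rule integrable_const_bound[of _ "(2^k)\<^sup>2"])
    show "AE \<omega> in M. norm ((g k (Z i \<omega>))\<^sup>2) \<le> (2^k)\<^sup>2"
      using g_bound[of k i] by (auto intro!: AE_I2 power_mono)
  qed (use that rvZ in measurable)
  have indep_g: "indep_vars (\<lambda>_. borel) (\<lambda>i \<omega>. g k (Z i \<omega>)) {1..2^k}" for k
    by (rule indep_vars_compose2[OF indep_vars_subset[OF indep]]) auto
  have T_mean: "expectation (T k) \<le> 2^k * \<mu>" for k
  proof -
    have int_g: "integrable M (\<lambda>\<omega>. g k (Z i \<omega>))" if "i \<ge> 1" for i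
      by (rule square_integrable_imp_integrable[OF _ g_sq]) (use that rvZ in measurable)
    have "(\<integral>x. g k x \<partial>D) \<le> \<mu>"
      unfolding \<mu>_def
    proof (rule integral_mono_AE)
      show "integrable D (g k)"
        by (rule Bochner_Integration.integrable_bound[OF int]) (auto simp: g_def indicator_def)
      show "AE x in D. g k x \<le> x"
        using D_nonneg by eventually_elim (auto simp: g_def indicator_def)
    qed (rule int)
    then have "(\<Sum>i\<in>{1..2^k}. expectation (\<lambda>\<omega>. g k (Z i \<omega>))) \<le> (\<Sum>i\<in>{1..2^k::nat}. \<mu>)"
      by (intro sum_mono) (simp add: law_int)
    then show ?thesis
      unfolding T_def using int_g by (simp add: Bochner_Integration.integral_sum)
  qed
  have T_var: "variance (T k) \<le> 2^k * (\<integral>x. (g k x)\<^sup>2 \<partial>D)" for k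
  proof -
    have "variance (T k) = (\<Sum>i\<in>{1..2^k}. variance (\<lambda>\<omega>. g k (Z i \<omega>)))"
      unfolding T_def by (rule variance_sum_indep(2)) (use indep_g g_sq in auto)
    also have "\<dots> \<le> (\<Sum>i\<in>{1..2^k::nat}. (\<integral>x. (g k x)\<^sup>2 \<partial>D))"
    proof (rule sum_mono)
      fix i assume i: "i \<in> {1..2^k::nat}"
      then have "integrable M (\<lambda>\<omega>. g k (Z i \<omega>))"
        by (intro square_integrable_imp_integrable[OF _ g_sq]) auto
      then have "variance (\<lambda>\<omega>. g k (Z i \<omega>)) \<le> expectation (\<lambda>\<omega>. (g k (Z i \<omega>))\<^sup>2)"
        using i by (subst variance_eq) (auto intro: g_sq)
      then show "variance (\<lambda>\<omega>. g k (Z i \<omega>)) \<le> (\<integral>x. (g k x)\<^sup>2 \<partial>D)"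
        using i law_int[of i "\<lambda>x. (g k x)\<^sup>2"] by simp
    qed
    finally show ?thesis by simp
  qed
  \<comment> \<open>\<open>E1\<close>: truncation at time \<open>2 ^ k\<close> has an effect; \<open>E2\<close>: the truncated
    sum is far from its mean.\<close>
  define E1 where "E1 k = {\<omega>\<in>space M. \<exists>i\<in>{1..2^k::nat}. 2^k < Z i \<omega>}" for k :: nat
  define E2 where "E2 k = {\<omega>\<in>space M. 2^k * \<eta> \<le> \<bar>T k \<omega> - expectation (T k)\<bar>}" for k :: nat
  have T_meas[measurable]: "random_variable borel (T k)" for k
    unfolding T_def by (intro borel_measurable_sum) auto
  have [measurable]: "E1 k \<in> events" "E2 k \<in> events" for k
  proof -
    have "E1 k = (\<Union>i\<in>{1..2^k}. {\<omega>\<in>space M. 2^k < Z i \<omega>})" by (auto simp: E1_def)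
    also have "\<dots> \<in> events" by (intro sets.finite_UN) auto
    finally show "E1 k \<in> events" .
    show "E2 k \<in> events" unfolding E2_def by measurable
  qed
  have P1: "prob (E1 k) \<le> 2^k * measure D {x. 2^k < x}" for k
  proof -
    have "E1 k = (\<Union>i\<in>{1..2^k}. {\<omega>\<in>space M. 2^k < Z i \<omega>})" by (auto simp: E1_def)
    then have "prob (E1 k) \<le> (\<Sum>i\<in>{1..2^k}. prob {\<omega>\<in>space M. 2^k < Z i \<omega>})"
      by (auto intro!: finite_measure_subadditive_finite)
    also have "\<dots> = (\<Sum>i\<in>{1..2^k::nat}. measure D {x. 2^k < x})"
    proof (rule sum.cong)
      fix i assume i: "i \<in> {1..2^k::nat}"
      then have "measure D {x. 2^k < x} = prob (Z i -` {x. 2^k < x} \<inter> space M)"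
        by (subst law[of i, symmetric]) (auto simp: measure_distr)
      then show "prob {\<omega>\<in>space M. 2^k < Z i \<omega>} = measure D {x. 2^k < x}"
        by (simp add: vimage_def Int_def conj_commute)
    qed simp
    finally show ?thesis by simp
  qed
  have P2: "prob (E2 k) \<le> ((\<integral>x. (g k x)\<^sup>2 \<partial>D) / 2^k) / \<eta>\<^sup>2" for k
  proof -
    have "integrable M (\<lambda>\<omega>. (T k \<omega>)\<^sup>2)"
      unfolding T_def by (rule variance_sum_indep(1)) (use indep_g g_sq in auto)
    then have "prob (E2 k) \<le> variance (T k) / (2^k * \<eta>)\<^sup>2"
      unfolding E2_def using \<eta> by (intro Chebyshev_inequality) auto
    also have "\<dots> \<le> (2^k * (\<integral>x. (g k x)\<^sup>2 \<partial>D)) / (2^k * \<eta>)\<^sup>2"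
      by (intro divide_right_mono T_var) auto
    also have "\<dots> = ((\<integral>x. (g k x)\<^sup>2 \<partial>D) / 2^k) / \<eta>\<^sup>2"
      using \<eta> by (simp add: power2_eq_square field_simps)
    finally show ?thesis .
  qed
  have "summable (\<lambda>k. prob (E1 k))"
    by (rule summable_comparison_test'[OF D.summable_dyadic_tails[OF int D_nonneg]])
      (use P1 in auto)
  then have 1: "AE \<omega> in M. \<forall>\<^sub>F k in sequentially. \<omega> \<in> space M - E1 k"
    by (intro borel_cantelli_AE1) (auto simp: emeasure_eq_measure)
  have "summable (\<lambda>k. prob (E2 k))"
    by (rule summable_comparison_test'[OF
        summable_divide[OF D.summable_dyadic_truncated_squares[OF int D_nonneg], of "\<eta>\<^sup>2"]])
      (use P2 in \<open>auto simp: g_def\<close>)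
  then have 2: "AE \<omega> in M. \<forall>\<^sub>F k in sequentially. \<omega> \<in> space M - E2 k"
    by (intro borel_cantelli_AE1) (auto simp: emeasure_eq_measure)
  have \<mu>_nonneg: "0 \<le> \<mu>"
    unfolding \<mu>_def using D_nonneg by (rule integral_nonneg_AE)
  from 1 2 show ?thesis
  proof eventually_elim
    case (elim \<omega>)
    then have "\<forall>\<^sub>F k in sequentially. (\<Sum>i=1..2^k. Z i \<omega>) \<le> 2^k * (\<mu> + \<eta>)"
    proof eventually_elim
      case (elim k)
      have "(\<Sum>i=1..2^k. Z i \<omega>) = T k \<omega>"
        unfolding T_def
      proof (intro sum.cong refl)
        fix i assume "i \<in> {1..2^k::nat}"
        then have "Z i \<omega> \<le> 2^k" using elim by (auto simp: E1_def not_less)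
        then show "Z i \<omega> = g k (Z i \<omega>)" by (simp add: g_def)
      qed
      also have "\<dots> \<le> expectation (T k) + 2^k * \<eta>"
        using elim by (auto simp: E2_def)
      also have "\<dots> \<le> 2^k * (\<mu> + \<eta>)"
        using T_mean[of k] by (simp add: algebra_simps)
      finally show ?case .
    qed
    then obtain K where K: "\<And>k. k \<ge> K \<Longrightarrow> (\<Sum>i=1..2^k. Z i \<omega>) \<le> 2^k * (\<mu> + \<eta>)"
      unfolding eventually_sequentially by blast
    show ?case
      unfolding eventually_sequentially
    proof (intro exI allI impI)
      fix n :: nat assume n: "2^K \<le> n"
      then have "n \<ge> 1" by (meson le_trans one_le_numeral one_le_power)
      then obtain k where k: "2^k \<le> n" "n < 2^(k+1)"
        using ex_power_ivl1[of 2 n] by auto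
      have "(2::nat)^K < 2^(k+1)" using n k by linarith
      then have "K \<le> k + 1"
        using power_less_imp_less_exp[of "2::nat" K "k + 1"] by simp
      have "(\<Sum>i=1..n. Z i \<omega>) \<le> (\<Sum>i=1..2^(k+1). Z i \<omega>)"
        using k nonneg by (intro sum_mono2) auto
      also have "\<dots> \<le> 2^(k+1) * (\<mu> + \<eta>)"
        using K \<open>K \<le> k + 1\<close> by blast
      also have "\<dots> = real (2^k) * (2 * \<mu> + c)"
        by (simp add: \<eta>_def algebra_simps)
      also have "\<dots> \<le> real n * (2 * \<mu> + c)"
        using k(1) \<mu>_nonneg c by (intro mult_right_mono, unfold of_nat_le_iff) auto
      finally show "(\<Sum>i=1..n. Z i \<omega>) \<le> real n * (2 * (\<integral>x. x \<partial>D) + c)"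
        by (simp add: \<mu>_def)
    qed
  qed
qed

text \<open>For indicator variables Hoeffding's inequality bounds the probability of a fixed deviation of
  the frequency at time \<open>n\<close> by a geometric sequence in \<open>n\<close>, and the Borel-Cantelli
  lemma applies to each of the countably many deviations \<open>1 / Suc m\<close>.\<close>

lemma (in prob_space) empirical_frequency_tendsto:
  fixes U :: "nat \<Rightarrow> 'a \<Rightarrow> real"
  assumes indep: "indep_vars (\<lambda>_. borel) U {1..}"
    and law: "\<And>i. i \<ge> 1 \<Longrightarrow> distr M borel (U i) = D"
    and A[measurable]: "A \<in> sets borel"
  shows "AE \<omega> in M. (\<lambda>n. real (card {i\<in>{1..n}. U i \<omega> \<in> A}) / real n) \<longlonglongrightarrow> measure D A"
proof -
  have rvU[measurable]: "random_variable borel (U i)" if "1 \<le> i" for i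
    using indep that unfolding indep_vars_def by auto
  define Y where "Y i \<omega> = indicat_real A (U i \<omega>)" for i \<omega>
  define p where "p = measure D A"
  have rvY[measurable]: "random_variable borel (Y i)" if "1 \<le> i" for i
    unfolding Y_def using that by measurable
  have p: "expectation (Y 1) = p"
  proof -
    have "expectation (Y 1) = (\<integral>x. indicator A x \<partial>distr M borel (U 1))"
      unfolding Y_def by (rule integral_distr[symmetric]) auto
    then show ?thesis using law[of 1] by (auto simp: p_def)
  qed
  have freq: "real (card {i\<in>{1..n}. U i \<omega> \<in> A}) = (\<Sum>i\<in>{1..n}. Y i \<omega>)" for n \<omega>
    by (simp add: Y_def indicator_def sum.If_cases Int_def)
  have lawY: "distr M borel (Y i) = distr M borel (Y 1)" if "i \<ge> 1" for i
  proof -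
    have "distr M borel (Y i) = distr (distr M borel (U i)) borel (indicat_real A)" if "i \<ge> 1" for i
      using that unfolding Y_def by (subst distr_distr) (auto simp: comp_def)
    then show ?thesis using that law by simp
  qed
  \<comment> \<open>The index is shifted to \<open>Suc n\<close> since the sample of size \<open>0\<close> has no frequency.\<close>
  have "AE \<omega> in M. \<forall>\<^sub>F n in sequentially.
      \<omega> \<in> space M - {\<omega>\<in>space M. \<bar>(\<Sum>i\<in>{1..Suc n}. Y i \<omega>) / real (Suc n) - p\<bar> \<ge> 1 / Suc m}" for m :: nat
  proof (rule borel_cantelli_AE1)
    have scale: "-2 * x * (1 / y)\<^sup>2 / (1 - 0)\<^sup>2 = x * (-2 / y\<^sup>2)" for x y :: real
      by (simp add: power_divide)
    let ?E = "\<lambda>n. {\<omega>\<in>space M. \<bar>(\<Sum>i\<in>{1..Suc n}. Y i \<omega>) / real (Suc n) - p\<bar> \<ge> 1 / Suc m}"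
    have bound: "prob (?E n) \<le> 2 * exp (-2 / (real (Suc m))\<^sup>2) ^ Suc n" for n
    proof -
      interpret Hoeffding_ineq_iid M "{1..Suc n}" Y "Y 1" 0 1 "expectation (Y 1)"
      proof unfold_locales
        have "indep_vars (\<lambda>_. borel) Y {1..}"
          unfolding Y_def by (rule indep_vars_compose2[OF indep]) measurable
        then show "indep_vars (\<lambda>_. borel) Y {1..Suc n}"
          by (rule indep_vars_subset) auto
        show "distr M borel (Y i) = distr M borel (Y 1)" if "i \<in> {1..Suc n}" for i
          using that by (intro lawY) simp
      qed (auto simp: Y_def indicator_def)
      have "prob (?E n) \<le> 2 * exp (-2 * real (Suc n) * (1 / Suc m)\<^sup>2 / (1 - 0)\<^sup>2)"
        using Hoeffding_ineq_abs_ge'[of "1 / Suc m"] unfolding p by (simp del: of_nat_Suc)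
      also have "-2 * real (Suc n) * (1 / Suc m)\<^sup>2 / (1 - 0)\<^sup>2 = real (Suc n) * (-2 / (real (Suc m))\<^sup>2)"
        by (rule scale)
      also have "exp \<dots> = exp (-2 / (real (Suc m))\<^sup>2) ^ Suc n"
        by (rule exp_of_nat_mult)
      finally show ?thesis .
    qed
    have "summable (\<lambda>n. 2 * exp (-2 / (real (Suc m))\<^sup>2) ^ Suc n)"
      unfolding summable_Suc_iff by (intro summable_mult summable_Suc_iff[THEN iffD2] summable_geometric) auto
    then show "summable (\<lambda>n. prob (?E n))"
      by (rule summable_comparison_test') (use bound in auto)
    show "?E n \<in> events" for n
      by measurable
  qed (auto simp: emeasure_eq_measure)
  then have "AE \<omega> in M. \<forall>m. \<forall>\<^sub>F n in sequentially.
      \<omega> \<in> space M - {\<omega>\<in>space M. \<bar>(\<Sum>i\<in>{1..Suc n}. Y i \<omega>) / real (Suc n) - p\<bar> \<ge> 1 / Suc m}"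
    unfolding AE_all_countable by blast
  then show ?thesis
  proof eventually_elim
    case (elim \<omega>)
    have "(\<lambda>n. (\<Sum>i\<in>{1..Suc n}. Y i \<omega>) / real (Suc n)) \<longlonglongrightarrow> p"
      unfolding tendsto_iff
    proof (intro allI impI)
      fix e :: real assume "e > 0"
      then obtain m where m: "1 / Suc m < e"
        using nat_approx_posE by blast
      show "\<forall>\<^sub>F n in sequentially. dist ((\<Sum>i\<in>{1..Suc n}. Y i \<omega>) / real (Suc n)) p < e"
        using elim[rule_format, of m] by eventually_elim (use m in \<open>auto simp: dist_real_def\<close>)
    qed
    then show ?case
      unfolding freq p_def[symmetric] by (rule LIMSEQ_imp_Suc)
  qed
qed

section \<open>Order statistics\<close>

lemma order_stat_in_sample:
  assumes "1 \<le> i" "i \<le> n"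
  shows "\<exists>k\<in>{1..n}. order_stat x n i = x k"
proof -
  have "order_stat x n i \<in> set (sort (map x [1..<Suc n]))"
    unfolding order_stat_def using assms by (intro nth_mem) auto
  then show ?thesis by auto
qed

lemma order_stat_mono_image:
  assumes "mono f" "1 \<le> i" "i \<le> n"
  shows "order_stat (\<lambda>k. f (x k)) n i = f (order_stat x n i)"
proof -
  have "sort (map f xs) = map f (sort xs)" for xs
    by (rule properties_for_sort)
      (auto simp: sorted_map intro: sorted_wrt_mono_rel[OF _ sorted_sort] monoD[OF assms(1)])
  from this[of "map x [1..<Suc n]"] show ?thesis
    unfolding order_stat_def using assms by (simp add: comp_def del: upt_Suc)
qed

text \<open>Sorting permutes the sample, and so leaves symmetric functions of it unchanged.\<close>

lemma sum_order_stat: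
  fixes h :: "real \<Rightarrow> 'b::comm_monoid_add"
  shows "(\<Sum>i=1..n. h (order_stat x n i)) = (\<Sum>i=1..n. h (x i))"
proof -
  let ?xs = "map x [1..<Suc n]"
  have "(\<Sum>i=1..n. h (order_stat x n i)) = (\<Sum>i<n. h (sort ?xs ! i))"
    unfolding order_stat_def
    by (rule sum.reindex_bij_witness[of _ Suc "\<lambda>i. i - 1"]) auto
  also have "\<dots> = sum_list (map h (sort ?xs))"
    by (subst sum_list_sum_nth) (simp add: atLeast0LessThan del: upt_Suc)
  also have "\<dots> = sum_mset (image_mset h (mset (sort ?xs)))"
    by (simp add: sum_mset_sum_list[symmetric] del: upt_Suc)
  also have "\<dots> = sum_list (map h ?xs)"
    by (simp add: sum_mset_sum_list[symmetric] image_mset.compositionality comp_def del: upt_Suc)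
  also have "\<dots> = (\<Sum>i=1..n. h (x i))"
    by (simp add: comp_def interv_sum_list_conv_sum_set_nat atLeastLessThanSuc_atLeastAtMost del: upt_Suc)
  finally show ?thesis .
qed

text \<open>The usual duality between order statistics and the empirical distribution function.\<close>

lemma order_stat_le_iff:
  assumes "1 \<le> i" "i \<le> n"
  shows "order_stat x n i \<le> q \<longleftrightarrow> i \<le> card {k\<in>{1..n}. x k \<le> q}"
proof -
  have "card {k\<in>{1..n}. x k \<le> q} = (\<Sum>k=1..n. of_bool (x k \<le> q))"
    by (simp add: Int_def)
  also have "\<dots> = (\<Sum>k=1..n. of_bool (order_stat x n k \<le> q))"
    by (rule sum_order_stat[symmetric])
  also have "\<dots> = card {k\<in>{1..n}. order_stat x n k \<le> q}"
    by (simp add: Int_def)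
  finally have card: "card {k\<in>{1..n}. x k \<le> q} = card {k\<in>{1..n}. order_stat x n k \<le> q}" .
  have mono: "order_stat x n k \<le> order_stat x n l" if "1 \<le> k" "k \<le> l" "l \<le> n" for k l
    unfolding order_stat_def using that by (intro sorted_nth_mono) (auto simp del: upt_Suc)
  show ?thesis
  proof
    assume "order_stat x n i \<le> q"
    then have "{1..i} \<subseteq> {k\<in>{1..n}. order_stat x n k \<le> q}"
      using mono assms by force
    then have "card {1..i} \<le> card {k\<in>{1..n}. order_stat x n k \<le> q}"
      by (intro card_mono) simp_all
    then show "i \<le> card {k\<in>{1..n}. x k \<le> q}"
      using card by simp
  next
    assume le: "i \<le> card {k\<in>{1..n}. x k \<le> q}"
    show "order_stat x n i \<le> q"
    proof (rule ccontr)
      assume "\<not> order_stat x n i \<le> q"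
      then have "{k\<in>{1..n}. order_stat x n k \<le> q} \<subseteq> {1..<i}"
        using mono[of i] assms(1) by (fastforce dest: order_trans simp: not_le[symmetric])
      then have "card {k\<in>{1..n}. order_stat x n k \<le> q} \<le> card {1..<i}"
        by (intro card_mono) simp_all
      then show False
        using le assms card by simp
    qed
  qed
qed

text \<open>A Glivenko-Cantelli statement for the uniform distribution, turned around: if the empirical
  distribution functions converge to the identity at rational points, then the \<open>i\<close>-th of
  \<open>n\<close> order statistics is near \<open>i / n\<close>, uniformly in \<open>i\<close>. By monotonicity
  it is enough to look at the finitely many grid points \<open>l / m\<close>; a value \<open>t = i / n\<close> is
  enclosed by grid points at distance less than \<open>2 / m\<close> from it and at least \<open>1 / m\<close>,
  so that the empirical distribution functions there, known up to \<open>1 / m\<close>, are on the right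
  side of \<open>t\<close>.\<close>

lemma order_stat_uniformly_near:
  fixes u :: "nat \<Rightarrow> real"
  assumes range: "\<And>k. 1 \<le> k \<Longrightarrow> 0 < u k \<and> u k < 1"
    and freq: "\<And>q. q \<in> \<rat> \<Longrightarrow> 0 < q \<Longrightarrow> q < 1 \<Longrightarrow>
      (\<lambda>n. real (card {k\<in>{1..n}. u k \<le> q}) / real n) \<longlonglongrightarrow> q"
    and \<delta>: "\<delta> > 0"
  shows "\<forall>\<^sub>F n in sequentially. \<forall>i\<in>{1..n}. \<bar>order_stat u n i - real i / real n\<bar> < \<delta>"
proof -
  obtain m' where m': "1 / real (Suc m') < \<delta> / 2"
    using nat_approx_posE[of "\<delta> / 2"] \<delta> by auto
  define m where "m = Suc m'"
  have m: "m > 0" "2 / real m < \<delta>" using m' by (auto simp: m_def)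
  have "\<forall>\<^sub>F n in sequentially. \<forall>l\<in>{1..<m}.
      \<bar>real (card {k\<in>{1..n}. u k \<le> real l / real m}) / real n - real l / real m\<bar> < 1 / real m"
  proof (rule eventually_ball_finite)
    show "\<forall>l\<in>{1..<m}. \<forall>\<^sub>F n in sequentially.
        \<bar>real (card {k\<in>{1..n}. u k \<le> real l / real m}) / real n - real l / real m\<bar> < 1 / real m"
    proof
      fix l assume l: "l \<in> {1..<m}"
      have "(\<lambda>n. real (card {k\<in>{1..n}. u k \<le> real l / real m}) / real n) \<longlonglongrightarrow> real l / real m"
        using l by (intro freq) auto
      from tendstoD[OF this, of "1 / real m"] m(1)
      show "\<forall>\<^sub>F n in sequentially.
          \<bar>real (card {k\<in>{1..n}. u k \<le> real l / real m}) / real n - real l / real m\<bar> < 1 / real m"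
        by (simp add: dist_real_def)
    qed
  qed simp
  then show ?thesis
  proof eventually_elim
    case (elim n)
    show ?case
    proof
      fix i assume i: "i \<in> {1..n}"
      then have n: "real n > 0" and t: "0 < real i / real n" "real i / real n \<le> 1" by auto
      define t where "t = real i / real n"
      define s where "s = order_stat u n i"
      have s01: "0 < s" "s < 1"
      proof -
        obtain k where "k \<in> {1..n}" "s = u k"
          using order_stat_in_sample[of i n u] i unfolding s_def by auto
        then show "0 < s" "s < 1" using range[of k] by simp_all
      qed
      have s_le: "s \<le> q \<longleftrightarrow> t \<le> real (card {k\<in>{1..n}. u k \<le> q}) / real n" for q
        unfolding s_def t_def using i n by (simp add: order_stat_le_iff divide_right_mono field_simps)
      have scale: "t + c / m = (m * t + c) / m" and scale': "t - c / m = (m * t - c) / m" for c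
        using m(1) by (simp_all add: add_divide_distrib diff_divide_distrib)
      have upper: "s \<le> t + 2 / m"
      proof (cases "t + 2 / m \<ge> 1")
        case False
        define l where "l = nat \<lceil>m * t\<rceil> + 1"
        have "m * t > 0" using t m(1) unfolding t_def by (intro mult_pos_pos) simp_all
        then have "real l = of_int \<lceil>m * t\<rceil> + 1" by (simp add: l_def)
        then have "real l < m * t + 2" "m * t + 1 \<le> real l" by linarith+
        then have l: "real l / m < t + 2 / m" "t + 1 / m \<le> real l / m"
          unfolding scale using m(1) by (auto intro: divide_strict_right_mono divide_right_mono)
        then have "real l / m < 1" using False by linarith
        then have "l \<in> {1..<m}" using m(1) by (auto simp: l_def)
        with elim have "\<bar>real (card {k\<in>{1..n}. u k \<le> real l / m}) / real n - real l / m\<bar> < 1 / m"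
          by blast
        then have "real l / m - 1 / m < real (card {k\<in>{1..n}. u k \<le> real l / m}) / real n"
          unfolding abs_less_iff by linarith
        then have "s \<le> real l / m"
          unfolding s_le using l by linarith
        then show ?thesis using l by linarith
      qed (use s01 in auto)
      have lower: "t - 2 / m \<le> s"
      proof (cases "t - 2 / m \<le> 0")
        case False
        define l where "l = nat (\<lfloor>m * t\<rfloor> - 1)"
        have "m * t > 2" using False m(1) by (simp add: field_simps)
        then have "real l = of_int \<lfloor>m * t\<rfloor> - 1" "\<lfloor>m * t\<rfloor> \<ge> 2"
          unfolding l_def by (auto simp: le_floor_iff)
        then have "m * t - 2 < real l" "real l \<le> m * t - 1" "l \<ge> 1" by linarith+
        then have l: "t - 2 / m < real l / m" "real l / m + 1 / m \<le> t" "l \<ge> 1"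
          using m(1) scale'[of 2] scale'[of 1]
          by (auto simp: le_diff_eq[symmetric] intro: divide_strict_right_mono divide_right_mono)
        then have "real l / m + 1 / m \<le> 1" using t by (simp add: t_def)
        then have "l \<in> {1..<m}" using m(1) l by (auto simp: field_simps)
        with elim have "\<bar>real (card {k\<in>{1..n}. u k \<le> real l / m}) / real n - real l / m\<bar> < 1 / m"
          by blast
        then have "real (card {k\<in>{1..n}. u k \<le> real l / m}) / real n < real l / m + 1 / m"
          unfolding abs_less_iff by linarith
        then have "\<not> s \<le> real l / m"
          unfolding s_le using l by linarith
        then show ?thesis using l by linarith
      qed (use s01 in auto)
      show "\<bar>order_stat u n i - real i / real n\<bar> < \<delta>"
        using upper lower m(2) unfolding s_def t_def by linarith
    qed
  qed
qed

section \<open>Integrals over an open interval\<close>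

text \<open>Each of the \<open>k\<close> cells has length \<open>1 / n\<close>, and replacing \<open>g\<close>
  there by its value at the right end point costs at most \<open>e / n\<close>.\<close>

lemma riemann_sum_error:
  fixes g :: "real \<Rightarrow> real"
  assumes cont: "continuous_on {0..1} g" and "n > 0"
    and osc: "\<And>s t. s \<in> {0..1} \<Longrightarrow> t \<in> {0..1} \<Longrightarrow> \<bar>s - t\<bar> \<le> 1 / real n \<Longrightarrow> \<bar>g s - g t\<bar> \<le> e"
  shows "k \<le> n \<Longrightarrow> \<bar>integral {0..real k / real n} g - (\<Sum>i=1..k. g (real i / real n)) / real n\<bar>
    \<le> real k * (e / real n)"
proof (induction k)
  case (Suc k)
  define a b where "a = real k / real n" and "b = real (Suc k) / real n"
  have ab: "0 \<le> a" "a \<le> b" "b \<le> 1" "b - a = 1 / real n"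
    using Suc.prems \<open>n > 0\<close> by (auto simp: a_def b_def field_simps)
  have cont_ab: "continuous_on {a..b} g" "continuous_on {0..b} g"
    by (rule continuous_on_subset[OF cont]; use ab in auto)+
  have "integral {0..b} g = integral {0..a} g + integral {a..b} g"
    using ab cont_ab by (intro Henstock_Kurzweil_Integration.integral_combine[symmetric]
        integrable_continuous_interval) auto
  moreover have "integral {a..b} (\<lambda>t. g t - g b) = integral {a..b} g - (b - a) * g b"
    using ab cont_ab by (subst Henstock_Kurzweil_Integration.integral_diff)
      (auto intro: integrable_continuous_interval)
  moreover have "norm (integral {a..b} (\<lambda>t. g t - g b)) \<le> e * (b - a)"
    using osc[of _ b] ab cont_ab by (intro integral_bound) (auto intro!: continuous_intros)
  moreover have "(\<Sum>i=1..Suc k. g (real i / real n)) / real n =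
      (\<Sum>i=1..k. g (real i / real n)) / real n + (b - a) * g b"
    unfolding ab by (simp add: b_def add_divide_distrib)
  moreover have "\<bar>integral {0..a} g - (\<Sum>i=1..k. g (real i / real n)) / real n\<bar> \<le> real k * (e / real n)"
    using Suc unfolding a_def by simp
  moreover have "real (Suc k) * (e / real n) = real k * (e / real n) + e * (b - a)"
    unfolding ab by (simp add: distrib_right add_divide_distrib add.commute)
  ultimately show ?case
    unfolding b_def[symmetric] real_norm_def by linarith
qed simp

lemma riemann_sums_tendsto:
  fixes g :: "real \<Rightarrow> real"
  assumes cont: "continuous_on {0..1} g"
  shows "(\<lambda>n. (\<Sum>i=1..n. g (real i / real n)) / real n) \<longlonglongrightarrow> (LBINT t:{0<..<1}. g t)"
proof -
  have "(LBINT t:{0<..<1}. g t) = (LBINT t=0..1. g t)"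
    by (subst interval_integral_Ioo) auto
  also have "\<dots> = integral {0..1} g"
    using interval_integral_eq_integral[of 0 1 g] borel_integrable_atLeastAtMost'[OF cont]
    by (simp add: zero_ereal_def one_ereal_def)
  finally have I: "(LBINT t:{0<..<1}. g t) = integral {0..1} g" .
  have "\<forall>\<^sub>F n in sequentially. dist ((\<Sum>i=1..n. g (real i / real n)) / real n) (integral {0..1} g) < e"
    if "e > 0" for e :: real
  proof -
    have "uniformly_continuous_on {0..1} g"
      using cont by (intro compact_uniformly_continuous) auto
    with that obtain d where d: "d > 0"
      "\<And>x y. x \<in> {0..1} \<Longrightarrow> y \<in> {0..1} \<Longrightarrow> dist y x < d \<Longrightarrow> dist (g y) (g x) < e / 2"
      unfolding uniformly_continuous_on_def by (meson half_gt_zero)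
    have "\<forall>\<^sub>F n in sequentially. 1 / real n < d"
      using tendstoD[OF lim_1_over_n[where 'a = real] d(1)] by simp
    with eventually_gt_at_top[of 0] show ?thesis
    proof eventually_elim
      case (elim n)
      have "\<bar>integral {0..1} g - (\<Sum>i=1..n. g (real i / n)) / n\<bar> \<le> e / 2"
        using riemann_sum_error[OF cont elim(1), of "e / 2" n] elim d(2)
        by (fastforce simp: dist_real_def)
      then show ?case using \<open>e > 0\<close> by (simp add: dist_real_def abs_minus_commute)
    qed
  qed
  then show ?thesis unfolding I tendsto_iff by blast
qed

text \<open>For a continuous function the improper Riemann integral is a limit of integrals over compact
  subintervals. Monotone convergence applied to \<open>\<bar>f\<bar>\<close> turns the convergence of these integrals
  into Lebesgue integrability, and dominated convergence then identifies the limit for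
  \<open>f\<close> itself.\<close>

lemma riemann_integrable_open_continuous:
  fixes f :: "real \<Rightarrow> real"
  assumes ab: "a < b" and cont: "continuous_on {a<..<b} f" and R: "riemann_integrable_open f a b"
  shows "set_integrable lborel {a<..<b} f"
    and "improper_riemann_integral f a b = (LBINT t:{a<..<b}. f t)"
proof -
  obtain u l :: "nat \<Rightarrow> real" where
    approx: "einterval a b = (\<Union>i. {l i .. u i})"
    "incseq u" "decseq l" "\<And>i. l i < u i" "\<And>i. ereal a < l i" "\<And>i. u i < ereal b"
    and lim: "l \<longlonglongrightarrow> ereal a" "u \<longlonglongrightarrow> ereal b"
    by (rule einterval_Icc_approximation[of "ereal a" "ereal b"]) (simp add: ab, rule that)
  have lu: "a < l i" "u i < b" for i using approx(5,6)[of i] by auto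
  have filt: "filterlim (\<lambda>i. (l i, u i)) (at_right a \<times>\<^sub>F at_left b) sequentially"
    using lim lu by (intro filterlim_Pair)
      (auto simp: filterlim_at less_imp_neq less_imp_neq[symmetric])
  have sub: "{l i..u i} \<subseteq> {a<..<b}" for i using lu[of i] by auto
  have improper_lim: "(\<lambda>i. LBINT x=l i..u i. g x) \<longlonglongrightarrow> I"
    if I: "has_improper_riemann_integral g I a b" and g: "continuous_on {a<..<b} g" for g I
  proof -
    have "((\<lambda>i. riemann_integral g (l i) (u i)) \<longlonglongrightarrow> I)"
      using filterlim_compose[OF _ filt, of "\<lambda>(c, d). riemann_integral g c d" "nhds I"] I
      by (simp add: has_improper_riemann_integral_def)
    moreover have "riemann_integral g (l i) (u i) = (LBINT x=l i..u i. g x)" for i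
    proof -
      obtain J where J: "has_riemann_integral g J (l i) (u i)"
        using I lu approx(4) unfolding has_improper_riemann_integral_def by blast
      have "integral {l i..u i} g = J"
        using has_riemann_integral_imp_has_integral[OF J] by (rule integral_unique)
      then show ?thesis
        using riemann_integral_eq[OF J] interval_integral_eq_integral[of "l i" "u i" g]
          borel_integrable_atLeastAtMost'[OF continuous_on_subset[OF g sub]] approx(4)[of i]
        by (simp add: less_imp_le)
    qed
    ultimately show ?thesis by simp
  qed
  obtain I J where I: "has_improper_riemann_integral f I a b"
    and J: "has_improper_riemann_integral (\<lambda>x. \<bar>f x\<bar>) J a b"
    using R unfolding riemann_integrable_open_def by blast
  have cont_abs: "continuous_on {a<..<b} (\<lambda>x. \<bar>f x\<bar>)"
    using cont by (intro continuous_intros)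
  have meas: "set_borel_measurable lborel {a<..<b} f" "set_borel_measurable lborel {a<..<b} (\<lambda>x. \<bar>f x\<bar>)"
    using borel_measurable_continuous_on_indicator[OF _ cont]
      borel_measurable_continuous_on_indicator[OF _ cont_abs]
    by (auto simp: set_borel_measurable_def)
  have "set_integrable lborel (einterval a b) (\<lambda>x. \<bar>f x\<bar>)"
    by (rule interval_integral_Icc_approx_nonneg(1)[OF _ approx lim _ _ _ improper_lim[OF J cont_abs]])
      (use ab meas(2) in \<open>auto intro!: borel_integrable_atLeastAtMost' continuous_on_subset[OF cont_abs sub]\<close>)
  then have abs: "set_integrable lborel {a<..<b} (\<lambda>x. \<bar>f x\<bar>)" by simp
  show int: "set_integrable lborel {a<..<b} f"
    unfolding set_integrable_def
    by (rule Bochner_Integration.integrable_bound[OF abs[unfolded set_integrable_def]])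
      (use meas(1) in \<open>auto simp: set_borel_measurable_def abs_mult\<close>)
  have "(\<lambda>i. LBINT x=l i..u i. f x) \<longlonglongrightarrow> (LBINT x=ereal a..ereal b. f x)"
    by (rule interval_integral_Icc_approx_integrable[OF _ approx lim]) (use ab int in auto)
  with improper_lim[OF I cont] have "I = (LBINT x=ereal a..ereal b. f x)"
    by (rule LIMSEQ_unique)
  also have "\<dots> = (LBINT t:{a<..<b}. f t)"
    using ab by (subst interval_integral_Ioo) auto
  finally show "improper_riemann_integral f a b = (LBINT t:{a<..<b}. f t)"
    using improper_riemann_integral_eq[OF I] by simp
qed

text \<open>The part of \<open>1 + \<bar>f\<bar>\<close> near the two ends of the unit interval. The summand \<open>1\<close>
  is included so that averages of this function also count the sample points near the ends.\<close>

definition end_part :: "(real \<Rightarrow> real) \<Rightarrow> real \<Rightarrow> real \<Rightarrow> real" where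
  "end_part f \<epsilon> t = (1 + \<bar>f t\<bar>) * indicator ({0<..<\<epsilon>} \<union> {1 - \<epsilon><..<1}) t"

lemma end_part_nonneg: "0 \<le> end_part f \<epsilon> t"
  by (simp add: end_part_def)

lemma end_part_mono: "\<epsilon> \<le> \<epsilon>' \<Longrightarrow> end_part f \<epsilon> t \<le> end_part f \<epsilon>' t"
  by (auto simp: end_part_def indicator_def)

lemma end_part_eq_0: "\<epsilon> \<le> 1 \<Longrightarrow> t \<notin> {0<..<1} \<Longrightarrow> end_part f \<epsilon> t = 0"
  by (auto simp: end_part_def)

lemma end_part_integrable:
  assumes "set_integrable lborel {0<..<1} f" "\<epsilon> \<le> 1"
  shows "integrable lborel (end_part f \<epsilon>)"
proof -
  have "set_integrable lborel {0<..<1} (\<lambda>t. 1 + \<bar>f t\<bar>)"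
    using assms(1) by (intro set_integral_add(1) set_integrable_abs)
      (auto simp: set_integrable_def)
  then have "set_integrable lborel ({0<..<\<epsilon>} \<inter> {..<1} \<union> {1 - \<epsilon><..<1}) (\<lambda>t. 1 + \<bar>f t\<bar>)"
    by (rule set_integrable_subset) (use assms(2) in auto)
  moreover have "{0<..<\<epsilon>} \<inter> {..<1} \<union> {1 - \<epsilon><..<1} = {0<..<\<epsilon>} \<union> {1 - \<epsilon><..<1}"
    using assms(2) by auto
  ultimately show ?thesis
    unfolding set_integrable_def end_part_def by (simp add: mult.commute)
qed

lemma end_part_integral_tendsto_0:
  assumes int: "set_integrable lborel {0<..<1} f"
  shows "(\<lambda>m. \<integral>t. end_part f (1 / Suc m) t \<partial>lborel) \<longlonglongrightarrow> 0"
proof -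
  have "(\<lambda>m. \<integral>t. end_part f (1 / Suc m) t \<partial>lborel) \<longlonglongrightarrow> (\<integral>t. 0 \<partial>(lborel :: real measure))"
  proof (rule integral_dominated_convergence[where w = "end_part f 1"])
    show "AE t in lborel. (\<lambda>m. end_part f (1 / Suc m) t) \<longlonglongrightarrow> 0"
    proof (rule AE_I2)
      fix t :: real
      show "(\<lambda>m. end_part f (1 / Suc m) t) \<longlonglongrightarrow> 0"
      proof (cases "0 < t \<and> t < 1")
        case True
        have "\<forall>\<^sub>F m in sequentially. 1 / real (Suc m) < min t (1 - t)"
          using tendstoD[OF LIMSEQ_Suc[OF lim_1_over_n[where 'a = real]], of "min t (1 - t)"] True
          by (simp add: dist_real_def abs_of_pos del: of_nat_Suc)
        then have "\<forall>\<^sub>F m in sequentially. end_part f (1 / Suc m) t = 0"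
          by eventually_elim (auto simp: end_part_def)
        then show ?thesis by (rule tendsto_eventually)
      next
        case False
        then have "end_part f (1 / Suc m) t = 0" for m :: nat
          by (intro end_part_eq_0) auto
        then show ?thesis by simp
      qed
    qed
    show "AE t in lborel. norm (end_part f (1 / Suc m) t) \<le> end_part f 1 t" for m :: nat
      using end_part_mono[of "1 / Suc m" 1 f] end_part_nonneg[of f] by auto
  qed (use end_part_integrable[OF int] in auto)
  then show ?thesis by simp
qed

section \<open>Averages of a function of several order statistics\<close>

text \<open>Uniform continuity at the points of a compact set \<open>S\<close>, with the other argument not
  confined to \<open>S\<close>. Here \<open>S\<close> will be a segment of the diagonal of the cube, while \<open>f\<close>
  may well be discontinuous off the diagonal.\<close>

lemma compact_isCont_uniform:
  fixes f :: "'a::metric_space \<Rightarrow> 'b::metric_space"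
  assumes "compact S" and cont: "\<And>x. x \<in> S \<Longrightarrow> isCont f x" and "e > 0"
  shows "\<exists>d>0. \<forall>x\<in>S. \<forall>y. dist y x < d \<longrightarrow> dist (f y) (f x) < e"
proof -
  define \<G> where "\<G> = {G. open G \<and> (\<forall>y\<in>G. \<forall>z\<in>G. dist (f y) (f z) < e)}"
  have "S \<subseteq> \<Union>\<G>"
  proof
    fix x assume "x \<in> S"
    then have "isCont f x" by (rule cont)
    with \<open>e > 0\<close> obtain r where r: "r > 0" "\<And>y. dist y x < r \<Longrightarrow> dist (f y) (f x) < e / 2"
      unfolding continuous_at_eps_delta by (meson half_gt_zero)
    have "ball x r \<in> \<G>"
      unfolding \<G>_def using dist_triangle_half_l[OF r(2) r(2)] by (auto simp: dist_commute[of x])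
    then show "x \<in> \<Union>\<G>" using r(1) by (meson UnionI centre_in_ball)
  qed
  from Heine_Borel_lemma[OF \<open>compact S\<close> this] obtain d
    where d: "d > 0" "\<And>x. x \<in> S \<Longrightarrow> \<exists>G\<in>\<G>. ball x d \<subseteq> G"
    unfolding \<G>_def by blast
  have "dist (f y) (f x) < e" if x: "x \<in> S" and y: "dist y x < d" for x y
  proof -
    obtain G where G: "G \<in> \<G>" "ball x d \<subseteq> G" using d(2)[OF x] by blast
    then have "x \<in> G" "y \<in> G" using y d(1) by (auto simp: dist_commute)
    then show ?thesis using G(1) unfolding \<G>_def by blast
  qed
  then show ?thesis using d(1) by blast
qed

lemma isCont_along_diagonal:
  fixes \<psi> :: "real ^ 'd \<Rightarrow> 'b::topological_space"
  assumes "isCont \<psi> (\<chi> j. t)"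
  shows "isCont (\<lambda>t. \<psi> (\<chi> j. t)) t"
  by (rule isCont_o2[where f = "\<lambda>t. \<chi> j. t"])
    (use assms in \<open>auto simp: isCont_def intro: tendsto_vec_lambda tendsto_ident_at\<close>)

lemma dist_diagonal_less:
  fixes s :: "'d::finite \<Rightarrow> real"
  assumes "\<And>j. \<bar>s j - t\<bar> < d / real CARD('d)"
  shows "dist (\<chi> j. s j) (\<chi> j. t) < d"
proof -
  have "dist (\<chi> j. s j) (\<chi> j. t) \<le> (\<Sum>j\<in>UNIV. \<bar>s j - t\<bar>)"
    unfolding dist_norm by (rule order_trans[OF norm_le_l1_cart]) simp
  also have "\<dots> < (\<Sum>j\<in>(UNIV :: 'd set). d / real CARD('d))"
    by (rule sum_strict_mono) (use assms in auto)
  finally show ?thesis by simp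
qed

text \<open>A piecewise linear weight that is \<open>1\<close> on \<open>{2 * \<epsilon>..1 - 2 * \<epsilon>}\<close> and
  \<open>0\<close> outside \<open>{\<epsilon>..1 - \<epsilon>}\<close>. Multiplying by a continuous weight instead of
  cutting off sharply keeps the Riemann sums within the reach of continuous functions.\<close>

definition cutoff :: "real \<Rightarrow> real \<Rightarrow> real" where
  "cutoff \<epsilon> t = max 0 (min 1 (min (t / \<epsilon> - 1) ((1 - t) / \<epsilon> - 1)))"

lemma
  assumes "\<epsilon> > 0"
  shows cutoff_bounds: "0 \<le> cutoff \<epsilon> t" "cutoff \<epsilon> t \<le> 1"
    and cutoff_eq_0: "t \<notin> {\<epsilon>..1 - \<epsilon>} \<Longrightarrow> cutoff \<epsilon> t = 0"
    and cutoff_eq_1: "t \<in> {2 * \<epsilon>..1 - 2 * \<epsilon>} \<Longrightarrow> cutoff \<epsilon> t = 1"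
proof -
  show "0 \<le> cutoff \<epsilon> t" "cutoff \<epsilon> t \<le> 1" by (auto simp: cutoff_def)
  assume "t \<notin> {\<epsilon>..1 - \<epsilon>}"
  then have "t / \<epsilon> < 1 \<or> (1 - t) / \<epsilon> < 1"
    using assms by (auto simp: pos_divide_less_eq)
  then show "cutoff \<epsilon> t = 0" by (auto simp: cutoff_def)
next
  assume "t \<in> {2 * \<epsilon>..1 - 2 * \<epsilon>}"
  then have "t / \<epsilon> \<ge> 2" "(1 - t) / \<epsilon> \<ge> 2"
    using assms by (auto simp: pos_le_divide_eq)
  then show "cutoff \<epsilon> t = 1" by (auto simp: cutoff_def)
qed

lemma continuous_cutoff_mult:
  fixes f :: "real \<Rightarrow> real"
  assumes "0 < \<epsilon>" "\<epsilon> \<le> 1 / 2" "continuous_on {0<..<1} f"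
  shows "continuous_on UNIV (\<lambda>t. cutoff \<epsilon> t * f t)"
proof -
  \<comment> \<open>Where the weight does not vanish, clamping the argument of \<open>f\<close> to
    \<open>{\<epsilon>..1 - \<epsilon>}\<close> has no effect.\<close>
  have "continuous_on UNIV (\<lambda>t. f (max \<epsilon> (min (1 - \<epsilon>) t)))"
    by (rule continuous_on_compose2[OF assms(3)]) (use assms(1,2) in \<open>auto intro!: continuous_intros\<close>)
  then have "continuous_on UNIV (\<lambda>t. cutoff \<epsilon> t * f (max \<epsilon> (min (1 - \<epsilon>) t)))"
    unfolding cutoff_def using assms(1) by (intro continuous_intros) auto
  moreover have "cutoff \<epsilon> t * f (max \<epsilon> (min (1 - \<epsilon>) t)) = cutoff \<epsilon> t * f t" for t
  proof (cases "t \<in> {\<epsilon>..1 - \<epsilon>}")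
    case True
    then have "max \<epsilon> (min (1 - \<epsilon>) t) = t" by auto
    then show ?thesis by simp
  qed (simp add: cutoff_eq_0[OF assms(1)])
  ultimately show ?thesis by simp
qed

text \<open>The deterministic core. Let \<open>t = i / n\<close>, let \<open>y\<close> be the vector of the \<open>i\<close>-th
  order statistics, all near \<open>t\<close>, and let \<open>w\<close> be the cutoff weight at \<open>t\<close>. Then
  \<open>\<psi> y - w * \<gamma> t\<close> is the sum of \<open>w * (\<psi> y - \<gamma> t)\<close>, uniformly small by
  continuity along a compact segment of the diagonal, and of \<open>(1 - w) * \<psi> y\<close>, which is nonzero
  only if all coordinates of \<open>y\<close> are near the same end of the unit interval. There the growth
  condition bounds it by a constant times the end parts of \<open>\<gamma>\<close> at the single coordinates. Summed over \<open>i\<close>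
  these are sums over the unsorted samples, separately for each coordinate, and the assumption
  \<open>ends\<close> makes them small. What remains are the Riemann sums of the continuous function
  \<open>w * \<gamma>\<close>, whose integral differs from that of \<open>\<gamma>\<close> by at most the
  integral of an end part.\<close>

lemma average_order_stats_tendsto:
  fixes \<psi> :: "real ^ 'd \<Rightarrow> real" and u :: "'d \<Rightarrow> nat \<Rightarrow> real"
  defines "\<gamma> \<equiv> \<lambda>t. \<psi> (\<chi> j. t)"
  assumes range: "\<And>j k. 1 \<le> k \<Longrightarrow> 0 < u j k \<and> u j k < 1"
    and near: "\<And>j \<delta>. \<delta> > 0 \<Longrightarrow>
      \<forall>\<^sub>F n in sequentially. \<forall>i\<in>{1..n}. \<bar>order_stat (u j) n i - real i / real n\<bar> < \<delta>"
    and cont: "\<And>t. 0 < t \<Longrightarrow> t < 1 \<Longrightarrow> isCont \<psi> (\<chi> j. t)"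
    and "c > 0"
    and bound: "\<And>x. \<forall>j. 0 < x $ j \<and> x $ j < 1 \<Longrightarrow> (\<forall>j. x $ j < c) \<or> (\<forall>j. 1 - c < x $ j) \<Longrightarrow>
      \<bar>\<psi> x\<bar> \<le> K * (1 + (\<Sum>j\<in>UNIV. \<bar>\<gamma> (x $ j)\<bar>))"
    and int: "set_integrable lborel {0<..<1} \<gamma>"
    and ends: "\<And>\<eta>. \<eta> > 0 \<Longrightarrow>
      \<exists>\<epsilon>>0. \<forall>j. \<forall>\<^sub>F n in sequentially. (\<Sum>k=1..n. end_part \<gamma> \<epsilon> (u j k)) \<le> real n * \<eta>"
  shows "(\<lambda>n. (\<Sum>i=1..n. \<psi> (\<chi> j. order_stat (u j) n i)) / real n) \<longlonglongrightarrow> (LBINT t:{0<..<1}. \<gamma> t)"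
  unfolding tendsto_iff
proof (intro allI impI)
  fix e :: real assume "e > 0"
  define C where "C = real CARD('d)"
  have C: "C \<ge> 1" by (simp add: C_def Suc_le_eq)
  \<comment> \<open>The final estimate collects three errors of size \<open>\<eta>\<close> and one of size
    \<open>\<bar>K\<bar> * C * \<eta>\<close>.\<close>
  define \<eta> where "\<eta> = e / (3 + \<bar>K\<bar> * C)"
  have \<eta>: "\<eta> > 0" unfolding \<eta>_def using \<open>e > 0\<close> C by (intro divide_pos_pos add_pos_nonneg) auto
  obtain \<epsilon>1 where \<epsilon>1: "\<epsilon>1 > 0"
    "\<And>j. \<forall>\<^sub>F n in sequentially. (\<Sum>k=1..n. end_part \<gamma> \<epsilon>1 (u j k)) \<le> real n * \<eta>"
    using ends[OF \<eta>] by blast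
  obtain \<epsilon>2 where \<epsilon>2: "0 < \<epsilon>2" "\<epsilon>2 \<le> 1" "(\<integral>t. end_part \<gamma> \<epsilon>2 t \<partial>lborel) < \<eta>"
  proof -
    have "\<forall>\<^sub>F m in sequentially. (\<integral>t. end_part \<gamma> (1 / Suc m) t \<partial>lborel) < \<eta>"
      using order_tendstoD(2)[OF end_part_integral_tendsto_0[OF int] \<eta>] .
    then obtain m where "(\<integral>t. end_part \<gamma> (1 / Suc m) t \<partial>lborel) < \<eta>"
      using eventually_happens'[OF sequentially_bot] by blast
    then show ?thesis by (intro that[of "1 / Suc m"]) auto
  qed
  define \<rho> where "\<rho> = min (min \<epsilon>1 \<epsilon>2) (min c 1)"
  \<comment> \<open>If \<open>t\<close> lies within \<open>2 * \<epsilon>\<close> of an end and the order statistics within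
    \<open>\<epsilon>\<close> of \<open>t\<close>, then these lie within \<open>\<rho>\<close> of the same end.\<close>
  define \<epsilon> where "\<epsilon> = \<rho> / 3"
  have \<rho>: "0 < \<rho>" "\<rho> \<le> \<epsilon>1" "\<rho> \<le> \<epsilon>2" "\<rho> \<le> c" "\<rho> \<le> 1"
    using \<epsilon>1(1) \<epsilon>2(1) \<open>c > 0\<close> by (auto simp: \<rho>_def)
  have \<epsilon>: "0 < \<epsilon>" "\<epsilon> \<le> 1 / 2" "\<rho> = 3 * \<epsilon>" using \<rho> by (auto simp: \<epsilon>_def)
  have sums_small: "\<forall>\<^sub>F n in sequentially. (\<Sum>k=1..n. end_part \<gamma> \<rho> (u j k)) \<le> real n * \<eta>" for j
    using \<epsilon>1(2)[of j]
  proof eventually_elim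
    case (elim n)
    have "(\<Sum>k=1..n. end_part \<gamma> \<rho> (u j k)) \<le> (\<Sum>k=1..n. end_part \<gamma> \<epsilon>1 (u j k))"
      by (intro sum_mono end_part_mono \<rho>)
    with elim show ?case by linarith
  qed
  have cont_\<gamma>: "continuous_on {0<..<1} \<gamma>"
  proof -
    have "isCont \<gamma> t" if "0 < t" "t < 1" for t
      unfolding \<gamma>_def by (intro isCont_along_diagonal cont that)
    then show ?thesis by (intro continuous_at_imp_continuous_on) auto
  qed
  define g where "g t = cutoff \<epsilon> t * \<gamma> t" for t
  have cont_g: "continuous_on UNIV g"
    unfolding g_def by (rule continuous_cutoff_mult[OF \<epsilon>(1,2) cont_\<gamma>])
  have g_near_\<gamma>: "\<bar>(LBINT t:{0<..<1}. g t) - (LBINT t:{0<..<1}. \<gamma> t)\<bar> \<le> \<eta>"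
  proof -
    have int_g: "set_integrable lborel {0<..<1} g"
      by (rule set_integrable_subset[OF borel_integrable_atLeastAtMost'[of 0 1 g]])
        (auto intro: continuous_on_subset[OF cont_g])
    have "\<bar>(LBINT t:{0<..<1}. g t) - (LBINT t:{0<..<1}. \<gamma> t)\<bar> = \<bar>LBINT t:{0<..<1}. g t - \<gamma> t\<bar>"
      by (simp add: set_integral_diff(2)[OF int_g int])
    also have "\<dots> \<le> (LBINT t:{0<..<1}. \<bar>g t - \<gamma> t\<bar>)"
      using set_integral_norm_bound[OF set_integral_diff(1)[OF int_g int]] by simp
    also have "\<dots> \<le> (\<integral>t. end_part \<gamma> \<epsilon>2 t \<partial>lborel)"
      unfolding set_lebesgue_integral_def
    proof (rule integral_mono)
      show "integrable lborel (\<lambda>t. indicator {0<..<1} t *\<^sub>R \<bar>g t - \<gamma> t\<bar>)"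
        using set_integrable_abs[OF set_integral_diff(1)[OF int_g int]]
        by (simp add: set_integrable_def)
      fix t :: real
      have "indicator {0<..<1} t *\<^sub>R \<bar>g t - \<gamma> t\<bar> \<le> end_part \<gamma> \<rho> t"
      proof (cases "t \<in> {2 * \<epsilon>..1 - 2 * \<epsilon>}")
        case True
        then show ?thesis
          using cutoff_eq_1[OF \<epsilon>(1) True] end_part_nonneg by (simp add: g_def)
      next
        case False
        have "g t - \<gamma> t = - ((1 - cutoff \<epsilon> t) * \<gamma> t)" by (simp add: g_def algebra_simps)
        then have "\<bar>g t - \<gamma> t\<bar> = (1 - cutoff \<epsilon> t) * \<bar>\<gamma> t\<bar>"
          using cutoff_bounds[OF \<epsilon>(1), of t] by (simp add: abs_mult)
        also have "\<dots> \<le> 1 * \<bar>\<gamma> t\<bar>"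
          using cutoff_bounds[OF \<epsilon>(1), of t] by (intro mult_right_mono) auto
        finally have "\<bar>g t - \<gamma> t\<bar> \<le> \<bar>\<gamma> t\<bar>" by simp
        then show ?thesis
          using False \<epsilon> by (auto simp: end_part_def indicator_def)
      qed
      also have "\<dots> \<le> end_part \<gamma> \<epsilon>2 t" by (rule end_part_mono[OF \<rho>(3)])
      finally show "indicator {0<..<1} t *\<^sub>R \<bar>g t - \<gamma> t\<bar> \<le> end_part \<gamma> \<epsilon>2 t" .
    qed (rule end_part_integrable[OF int \<epsilon>2(2)])
    finally show ?thesis using \<epsilon>2(3) by linarith
  qed
  have "\<exists>d>0. \<forall>x\<in>(\<lambda>t. \<chi> j. t) ` {\<epsilon>..1 - \<epsilon>}. \<forall>y. dist y x < d \<longrightarrow> dist (\<psi> y) (\<psi> x) < \<eta>"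
  proof (rule compact_isCont_uniform[OF compact_continuous_image _ \<eta>])
    show "continuous_on {\<epsilon>..1 - \<epsilon>} (\<lambda>t. \<chi> j::'d. t)" by (intro continuous_intros)
  qed (use cont \<epsilon>(1) in auto)
  then obtain d where d: "d > 0"
    "\<And>t y. t \<in> {\<epsilon>..1 - \<epsilon>} \<Longrightarrow> dist y (\<chi> j. t) < d \<Longrightarrow> \<bar>\<psi> y - \<gamma> t\<bar> < \<eta>"
    unfolding \<gamma>_def by (auto simp: dist_real_def)
  define \<delta> where "\<delta> = min \<epsilon> (d / C)"
  have \<delta>: "\<delta> > 0" "\<delta> \<le> \<epsilon>" "\<delta> \<le> d / C" using \<epsilon> d(1) C by (auto simp: \<delta>_def)
  have "\<forall>\<^sub>F n in sequentially. \<forall>j. \<forall>i\<in>{1..n}. \<bar>order_stat (u j) n i - real i / real n\<bar> < \<delta>"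
    by (intro eventually_all_finite near \<delta>)
  moreover have "\<forall>\<^sub>F n in sequentially. \<forall>j. (\<Sum>k=1..n. end_part \<gamma> \<rho> (u j k)) \<le> real n * \<eta>"
    by (intro eventually_all_finite sums_small)
  moreover have "\<forall>\<^sub>F n in sequentially.
      dist ((\<Sum>i=1..n. g (real i / real n)) / real n) (LBINT t:{0<..<1}. g t) < \<eta>"
    using tendstoD[OF riemann_sums_tendsto[OF continuous_on_subset[OF cont_g]] \<eta>] by simp
  ultimately show "\<forall>\<^sub>F n in sequentially.
      dist ((\<Sum>i=1..n. \<psi> (\<chi> j. order_stat (u j) n i)) / real n) (LBINT t:{0<..<1}. \<gamma> t) < e"
    using eventually_gt_at_top[of 0]
  proof eventually_elim
    case (elim n)
    then have n: "real n > 0" by simp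
    define s where "s i j = order_stat (u j) n i" for i j
    have term_bound: "\<bar>\<psi> (\<chi> j. s i j) - g (real i / real n)\<bar> \<le> \<eta> + \<bar>K\<bar> * (\<Sum>j\<in>UNIV. end_part \<gamma> \<rho> (s i j))"
      if i: "i \<in> {1..n}" for i
    proof -
      define t where "t = real i / real n"
      have st: "\<bar>s i j - t\<bar> < \<delta>" for j using elim(1) i by (simp add: s_def t_def)
      have s01: "0 < s i j \<and> s i j < 1" for j
        using order_stat_in_sample[of i n "u j"] i range unfolding s_def by fastforce
      define w where "w = cutoff \<epsilon> t"
      have w: "0 \<le> w" "w \<le> 1" using cutoff_bounds[OF \<epsilon>(1), of t] by (auto simp: w_def)
      have mid: "w * \<bar>\<psi> (\<chi> j. s i j) - \<gamma> t\<bar> \<le> \<eta>"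
      proof (cases "t \<in> {\<epsilon>..1 - \<epsilon>}")
        case True
        have "\<bar>s i j - t\<bar> < d / real CARD('d)" for j
          using st[of j] \<delta>(3) by (simp add: C_def)
        from d(2)[OF True dist_diagonal_less[of "s i", OF this]]
        have "w * \<bar>\<psi> (\<chi> j. s i j) - \<gamma> t\<bar> \<le> 1 * \<eta>" using w by (intro mult_mono) auto
        then show ?thesis by simp
      qed (use cutoff_eq_0[OF \<epsilon>(1)] \<eta> in \<open>simp add: w_def\<close>)
      have ends: "(1 - w) * \<bar>\<psi> (\<chi> j. s i j)\<bar> \<le> \<bar>K\<bar> * (\<Sum>j\<in>UNIV. end_part \<gamma> \<rho> (s i j))"
      proof (cases "t \<in> {2 * \<epsilon>..1 - 2 * \<epsilon>}")
        case True
        then show ?thesis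
          using cutoff_eq_1[OF \<epsilon>(1) True] by (simp add: w_def sum_nonneg end_part_nonneg)
      next
        case False
        have "s i j < \<rho>" if "t < 2 * \<epsilon>" for j
          using st[of j] \<delta>(2) \<epsilon>(3) that unfolding abs_less_iff by linarith
        moreover have "1 - \<rho> < s i j" if "1 - 2 * \<epsilon> < t" for j
          using st[of j] \<delta>(2) \<epsilon>(3) that unfolding abs_less_iff by linarith
        ultimately have side: "(\<forall>j. s i j < \<rho>) \<or> (\<forall>j. 1 - \<rho> < s i j)"
          using False by (auto simp: not_le)
        have side_c: "(\<forall>j. s i j < c) \<or> (\<forall>j. 1 - c < s i j)"
          using side \<rho>(4) by (smt (verit))
        have "(1 - w) * \<bar>\<psi> (\<chi> j. s i j)\<bar> \<le> 1 * \<bar>\<psi> (\<chi> j. s i j)\<bar>"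
          using w by (intro mult_right_mono) auto
        also have "\<dots> \<le> K * (1 + (\<Sum>j\<in>UNIV. \<bar>\<gamma> (s i j)\<bar>))"
          using bound[of "\<chi> j. s i j"] s01 side_c by simp
        also have "\<dots> \<le> \<bar>K\<bar> * (1 + (\<Sum>j\<in>UNIV. \<bar>\<gamma> (s i j)\<bar>))"
          by (intro mult_right_mono add_nonneg_nonneg sum_nonneg) auto
        \<comment> \<open>Since \<open>C \<ge> 1\<close>, the constant can be shared out among the coordinates.\<close>
        also have "\<dots> \<le> \<bar>K\<bar> * (C + (\<Sum>j\<in>UNIV. \<bar>\<gamma> (s i j)\<bar>))"
          using C by (intro mult_left_mono) auto
        also have "C + (\<Sum>j\<in>UNIV. \<bar>\<gamma> (s i j)\<bar>) = (\<Sum>j\<in>UNIV. 1 + \<bar>\<gamma> (s i j)\<bar>)"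
          by (simp add: C_def sum.distrib)
        also have "\<dots> = (\<Sum>j\<in>UNIV. end_part \<gamma> \<rho> (s i j))"
          using side s01 by (intro sum.cong) (auto simp: end_part_def indicator_def)
        finally show ?thesis .
      qed
      have "\<psi> (\<chi> j. s i j) - g t = w * (\<psi> (\<chi> j. s i j) - \<gamma> t) + (1 - w) * \<psi> (\<chi> j. s i j)"
        by (simp add: g_def w_def algebra_simps)
      then have "\<bar>\<psi> (\<chi> j. s i j) - g t\<bar> \<le> w * \<bar>\<psi> (\<chi> j. s i j) - \<gamma> t\<bar> + (1 - w) * \<bar>\<psi> (\<chi> j. s i j)\<bar>"
        using w abs_triangle_ineq by (metis abs_mult abs_of_nonneg diff_ge_0_iff_ge)
      then show ?thesis using mid ends unfolding t_def by linarith
    qed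
    define A where "A = (\<Sum>i=1..n. \<psi> (\<chi> j. s i j))"
    define B where "B = (\<Sum>i=1..n. g (real i / real n))"
    have "\<bar>A - B\<bar> \<le> (\<Sum>i=1..n. \<bar>\<psi> (\<chi> j. s i j) - g (real i / real n)\<bar>)"
      unfolding A_def B_def sum_subtractf[symmetric] by (rule sum_abs)
    also have "\<dots> \<le> (\<Sum>i=1..n. \<eta> + \<bar>K\<bar> * (\<Sum>j\<in>UNIV. end_part \<gamma> \<rho> (s i j)))"
      by (intro sum_mono term_bound) auto
    also have "\<dots> = real n * \<eta> + \<bar>K\<bar> * (\<Sum>j\<in>UNIV. \<Sum>i=1..n. end_part \<gamma> \<rho> (s i j))"
      by (subst sum.swap) (simp add: sum.distrib sum_distrib_left)
    also have "\<dots> = real n * \<eta> + \<bar>K\<bar> * (\<Sum>j\<in>UNIV. \<Sum>k=1..n. end_part \<gamma> \<rho> (u j k))"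
      unfolding s_def by (simp only: sum_order_stat)
    also have "\<dots> \<le> real n * \<eta> + \<bar>K\<bar> * (\<Sum>j\<in>(UNIV :: 'd set). real n * \<eta>)"
      using elim(2) by (intro add_left_mono mult_left_mono sum_mono) auto
    also have "\<dots> = real n * (\<eta> * (1 + \<bar>K\<bar> * C))"
      by (simp add: C_def algebra_simps)
    finally have "\<bar>A - B\<bar> / real n \<le> \<eta> * (1 + \<bar>K\<bar> * C)"
      using n by (simp add: pos_divide_le_eq mult.commute)
    then have "\<bar>A / n - B / n\<bar> \<le> \<eta> * (1 + \<bar>K\<bar> * C)"
      using n by (simp add: diff_divide_distrib[symmetric])
    moreover have "\<bar>B / n - (LBINT t:{0<..<1}. g t)\<bar> < \<eta>"
      using elim(3) by (simp add: dist_real_def B_def)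
    ultimately have "\<bar>A / n - (LBINT t:{0<..<1}. \<gamma> t)\<bar> < \<eta> * (3 + \<bar>K\<bar> * C)"
      using g_near_\<gamma> \<eta> unfolding distrib_left by linarith
    also have "\<dots> = e"
      unfolding \<eta>_def using C by (simp add: add_nonneg_eq_0_iff)
    finally show ?case by (simp add: dist_real_def A_def s_def)
  qed
qed

section \<open>The probability integral transform\<close>

abbreviation uniform01 :: "real measure" where
  "uniform01 \<equiv> distr (restrict_space lborel {0<..<1}) borel (\<lambda>t. t)"

lemma measurable_ident_unit_interval [measurable]:
  "(\<lambda>t. t) \<in> restrict_space lborel {0<..<1} \<rightarrow>\<^sub>M (borel :: real measure)"
  by (rule measurable_restrict_space1) simp

lemma measure_uniform01_atMost:
  assumes "0 < q" "q < 1"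
  shows "measure uniform01 {..q} = q"
proof -
  have "measure uniform01 {..q} = measure (restrict_space lborel {0<..<1}) {0<..q}"
    using assms by (subst measure_distr)
      (auto simp: space_restrict_space intro!: arg_cong[where f = "measure _"])
  also have "\<dots> = measure lborel {0<..q}"
    using assms by (subst measure_restrict_space) auto
  finally show ?thesis using assms by simp
qed

lemma
  fixes f :: "real \<Rightarrow> real"
  assumes f: "f \<in> borel_measurable borel"
  shows integrable_uniform01: "integrable uniform01 f \<longleftrightarrow> set_integrable lborel {0<..<1} f"
    and integral_uniform01: "(\<integral>t. f t \<partial>uniform01) = (LBINT t:{0<..<1}. f t)"
proof -
  show "integrable uniform01 f \<longleftrightarrow> set_integrable lborel {0<..<1} f"
    using f by (subst integrable_distr_eq)
      (simp_all add: set_integrable_eq)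
  show "(\<integral>t. f t \<partial>uniform01) = (LBINT t:{0<..<1}. f t)"
    using f by (subst integral_distr) (simp_all add: set_lebesgue_integral_def integral_restrict_space)
qed

context cdf_distribution
begin

text \<open>The inequality \<open>t \<le> C (quantile C t)\<close> holds for every distribution function; continuity is
  needed for \<open>t\<close> to be attained at all, which gives the converse.\<close>

lemma cdf_quantile:
  assumes cont: "continuous_on UNIV C" and t: "0 < t" "t < 1"
  shows "C (quantile C t) = t"
proof (rule antisym)
  have galois: "t \<le> C x \<longleftrightarrow> quantile C t \<le> x" for x
    unfolding quantile_def by (rule pseudoinverse[OF t])
  then show "t \<le> C (quantile C t)" by simp
  obtain y where y: "C y < t"
    using order_tendstoD(2)[OF bot t(1)] eventually_happens'[OF trivial_limit_at_bot_linorder] by blast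
  obtain z where z: "t < C z"
    using order_tendstoD(1)[OF top t(2)] eventually_happens'[OF trivial_limit_at_top_linorder] by blast
  have "y \<le> z" using y z mono monoD[OF mono, of z y] by linarith
  then obtain x where "C x = t"
    using IVT'[of C y t z] y z continuous_on_subset[OF cont] by auto
  then show "C (quantile C t) \<le> t"
    using galois[of x] monoD[OF mono, of "quantile C t" x] by simp
qed

text \<open>The law is the image of the uniform law under the quantile function, so that what holds for
  \<open>C\<close> composed with the quantile function, almost everywhere on \<open>(0, 1)\<close>, holds for
  \<open>C\<close> almost surely. The same transfer proves the lemma after this one.\<close>

lemma distr_cdf_eq_uniform01:
  assumes cont: "continuous_on UNIV C"
  shows "distr M borel C = uniform01"
proof -
  have "distr M borel C = distr (distr (restrict_space lborel {0<..<1}) borel I) borel C"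
    by (simp add: distr_I_eq_M)
  also have "\<dots> = distr (restrict_space lborel {0<..<1}) borel (C \<circ> I)"
    by (rule distr_distr) (auto simp: measurable_restrict_space1)
  also have "\<dots> = uniform01"
    using cdf_quantile[OF cont]
    by (intro distr_cong) (auto simp: space_restrict_space quantile_def)
  finally show ?thesis .
qed

lemma AE_quantile_cdf:
  assumes cont: "continuous_on UNIV C"
  shows "AE x in M. 0 < C x \<and> C x < 1 \<and> quantile C (C x) = x"
proof -
  let ?L = "restrict_space lborel {0<..<1::real}"
  \<comment> \<open>A version of the quantile function that is Borel measurable on the whole line.\<close>
  define h where "h t = indicator {0<..<1} t * I t" for t
  have [measurable]: "h \<in> borel_measurable borel"
    unfolding h_def using measurable_CI
    by (subst (asm) borel_measurable_restrict_space_iff) (simp_all add: mult.commute)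
  have I[measurable]: "I \<in> borel_measurable ?L"
    using measurable_CI by (simp cong: measurable_cong_sets add: sets_restrict_space)
  have iff: "0 < C x \<and> C x < 1 \<and> quantile C (C x) = x \<longleftrightarrow> 0 < C x \<and> C x < 1 \<and> h (C x) = x" for x
    by (auto simp: h_def quantile_def)
  have "AE x in distr ?L borel I. 0 < C x \<and> C x < 1 \<and> h (C x) = x"
  proof (subst AE_distr_iff[OF I])
    show "AE t in ?L. 0 < C (I t) \<and> C (I t) < 1 \<and> h (C (I t)) = I t"
      using cdf_quantile[OF cont] by (intro AE_I2) (auto simp: space_restrict_space h_def quantile_def)
  qed measurable
  then show ?thesis unfolding distr_I_eq_M iff .
qed

end

section \<open>Almost sure convergence\<close>

theorem theorem1p1:
  fixes M :: "'a measure"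
    and X :: "nat \<Rightarrow> 'a \<Rightarrow> real ^ 'd"
    and F :: "'d \<Rightarrow> real \<Rightarrow> real"
    and \<phi> :: "real ^ 'd \<Rightarrow> real"
  assumes "prob_space M"
    and "\<And>i. i \<ge> 1 \<Longrightarrow> X i \<in> borel_measurable M"
    and "\<And>j. prob_space.indep_vars M (\<lambda>_. borel) (\<lambda>i \<omega>. X i \<omega> $ j) {1..}"
    and "\<And>i j. i \<ge> 1 \<Longrightarrow> cdf (distr M borel (\<lambda>\<omega>. X i \<omega> $ j)) = F j"
    and "\<phi> \<in> borel_measurable borel"
    and "\<And>u. 0 < u \<Longrightarrow> u < 1 \<Longrightarrow> isCont (psi \<phi> F) (\<chi> j. u)"
    and "\<exists>K. \<exists>c\<^sub>0>0. \<forall>x. (\<forall>j. 0 < x $ j \<and> x $ j < 1) \<longrightarrow>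
           (\<forall>j. x $ j < c\<^sub>0) \<or> (\<forall>j. 1 - c\<^sub>0 < x $ j) \<longrightarrow>
           \<bar>psi \<phi> F x\<bar> \<le> K * (1 + (\<Sum>j\<in>UNIV. \<bar>gamma \<phi> F (x $ j)\<bar>))"
    and "\<And>j. continuous_on UNIV (F j)"
    and "riemann_integrable_open (gamma \<phi> F) 0 1"
  shows "AE \<omega> in M.
    (\<lambda>n. (\<Sum>i=1..n. \<phi> (\<chi> j. order_stat (\<lambda>k. X k \<omega> $ j) n i)) / real n)
      \<longlonglongrightarrow> improper_riemann_integral (gamma \<phi> F) 0 1"
proof -
  interpret prob_space M by fact
  define \<psi> where "\<psi> = psi \<phi> F"
  define \<gamma> where "\<gamma> = gamma \<phi> F"
  have \<gamma>_\<psi>: "\<gamma> = (\<lambda>t. \<psi> (\<chi> j. t))" by (simp add: \<gamma>_def \<psi>_def gamma_def fun_eq_iff)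
  have cont_\<psi>: "isCont \<psi> (\<chi> j. t)" if "0 < t" "t < 1" for t
    using assms(6)[OF that] by (simp add: \<psi>_def)
  have "isCont \<gamma> t" if "0 < t" "t < 1" for t
    unfolding \<gamma>_\<psi> by (intro isCont_along_diagonal cont_\<psi> that)
  then have "continuous_on {0<..<1} \<gamma>" by (intro continuous_at_imp_continuous_on) auto
  from riemann_integrable_open_continuous[OF _ this] assms(9)
  have int_\<gamma>: "set_integrable lborel {0<..<1} \<gamma>"
    and value_\<gamma>: "improper_riemann_integral \<gamma> 0 1 = (LBINT t:{0<..<1}. \<gamma> t)"
    by (simp_all add: \<gamma>_def)
  have rvX[measurable]: "random_variable borel (\<lambda>\<omega>. X i \<omega> $ j)" if "1 \<le> i" for i j
    using assms(3)[of j] that unfolding indep_vars_def by auto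
  have D: "cdf_distribution (distr M borel (\<lambda>\<omega>. X i \<omega> $ j))" if "1 \<le> i" for i j
    unfolding cdf_distribution_def using that by (intro real_distribution_distr) measurable
  have mono_F: "mono (F j)" for j
  proof -
    interpret L: cdf_distribution "distr M borel (\<lambda>\<omega>. X 1 \<omega> $ j)" by (rule D) simp
    show ?thesis using L.mono assms(4)[of 1 j] by simp
  qed
  then have [measurable]: "F j \<in> borel_measurable borel" for j
    by (intro borel_measurable_mono)
  define U where "U j k \<omega> = F j (X k \<omega> $ j)" for j k \<omega>
  have indepU: "indep_vars (\<lambda>_. borel) (U j) {1..}" for j
    unfolding U_def by (rule indep_vars_compose2[OF assms(3)]) measurable
  have lawU: "distr M borel (U j k) = uniform01" if "1 \<le> k" for j k
  proof -
    interpret L: cdf_distribution "distr M borel (\<lambda>\<omega>. X k \<omega> $ j)" by (rule D[OF that])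
    have "distr M borel (U j k) = distr (distr M borel (\<lambda>\<omega>. X k \<omega> $ j)) borel (F j)"
      using that unfolding U_def by (subst distr_distr) (auto simp: comp_def)
    then show ?thesis
      using L.distr_cdf_eq_uniform01 assms(4)[OF that, of j] assms(8)[of j] by simp
  qed
  have "AE \<omega> in M. 0 < U j k \<omega> \<and> U j k \<omega> < 1 \<and> quantile (F j) (U j k \<omega>) = X k \<omega> $ j"
    if "1 \<le> k" for j k
  proof -
    interpret L: cdf_distribution "distr M borel (\<lambda>\<omega>. X k \<omega> $ j)" by (rule D[OF that])
    have "AE x in distr M borel (\<lambda>\<omega>. X k \<omega> $ j). 0 < F j x \<and> F j x < 1 \<and> quantile (F j) (F j x) = x"
      using L.AE_quantile_cdf assms(4)[OF that, of j] assms(8)[of j] by simp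
    from AE_distrD[OF _ this] show ?thesis using that by (simp add: U_def)
  qed
  then have range: "AE \<omega> in M. \<forall>j. \<forall>k\<in>{1..}. 0 < U j k \<omega> \<and> U j k \<omega> < 1 \<and> quantile (F j) (U j k \<omega>) = X k \<omega> $ j"
    by (simp add: AE_all_countable AE_ball_countable)
  have freq: "AE \<omega> in M. \<forall>j. \<forall>q\<in>\<rat> \<inter> {0<..<1}.
      (\<lambda>n. real (card {k\<in>{1..n}. U j k \<omega> \<in> {..q}}) / real n) \<longlonglongrightarrow> q"
  proof -
    have "AE \<omega> in M. (\<lambda>n. real (card {k\<in>{1..n}. U j k \<omega> \<in> {..q}}) / real n) \<longlonglongrightarrow> q"
      if "0 < q" "q < 1" for j q
      using empirical_frequency_tendsto[OF indepU lawU, of "{..q}" j] measure_uniform01_atMost[OF that]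
      by simp
    then show ?thesis
      by (subst AE_all_countable, intro allI, subst AE_ball_countable) (auto intro: countable_rat)
  qed
  define E where "E m = (\<integral>t. end_part \<gamma> (1 / Suc m) t \<partial>lborel)" for m :: nat
  \<comment> \<open>The end parts shrink as \<open>m\<close> grows, so that \<open>E m\<close> and with it the whole
    bound tends to \<open>0\<close>. Countably many \<open>m\<close> keep the exceptional set null.\<close>
  have ends: "AE \<omega> in M. \<forall>j. \<forall>m. \<forall>\<^sub>F n in sequentially.
      (\<Sum>k=1..n. end_part \<gamma> (1 / Suc m) (U j k \<omega>)) \<le> real n * (2 * E m + 1 / Suc m)"
  proof -
    have "AE \<omega> in M. \<forall>\<^sub>F n in sequentially.
        (\<Sum>k=1..n. end_part \<gamma> (1 / Suc m) (U j k \<omega>)) \<le> real n * (2 * E m + 1 / Suc m)" for j and m :: nat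
    proof -
      define h where "h = end_part \<gamma> (1 / Suc m)"
      have h_nonneg: "0 \<le> h t" for t by (simp add: h_def end_part_nonneg)
      have int_h: "integrable lborel h" unfolding h_def by (rule end_part_integrable[OF int_\<gamma>]) simp
      then have meas_h[measurable]: "h \<in> borel_measurable borel" by auto
      have restrict: "indicator {0<..<1} t *\<^sub>R h t = h t" for t
        by (cases "t \<in> {0<..<1}") (simp_all add: h_def end_part_eq_0 del: of_nat_Suc)
      have law: "distr M borel (\<lambda>\<omega>. h (U j k \<omega>)) = distr uniform01 borel h" if "1 \<le> k" for k
      proof -
        have "random_variable borel (U j k)" unfolding U_def using that by measurable
        then have "distr M borel (\<lambda>\<omega>. h (U j k \<omega>)) = distr (distr M borel (U j k)) borel h"
          by (subst distr_distr) (auto simp: comp_def)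
        then show ?thesis by (simp only: lawU[OF that])
      qed
      have "integrable uniform01 h"
        unfolding integrable_uniform01[OF meas_h] set_integrable_def restrict
        by (rule int_h)
      then have 1: "integrable (distr uniform01 borel h) (\<lambda>x. x)"
        by (subst integrable_distr_eq) auto
      have "(\<integral>x. x \<partial>distr uniform01 borel h) = (\<integral>t. h t \<partial>uniform01)"
        by (rule integral_distr) auto
      also have "\<dots> = E m"
        unfolding integral_uniform01[OF meas_h] set_lebesgue_integral_def restrict E_def
        by (simp only: h_def)
      finally have 2: "(\<integral>x. x \<partial>distr uniform01 borel h) = E m" .
      have "indep_vars (\<lambda>_. borel) (\<lambda>k \<omega>. h (U j k \<omega>)) {1..}"
        by (rule indep_vars_compose2[OF indepU]) measurable
      from iid_average_eventually_bounded[OF this law h_nonneg 1, of "1 / Suc m"]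
      show ?thesis unfolding 2 h_def[symmetric] by simp
    qed
    then show ?thesis by (simp add: AE_all_countable)
  qed
  have ends_vanish: "(\<lambda>m. 2 * E m + 1 / Suc m) \<longlonglongrightarrow> 0"
    using tendsto_add[OF tendsto_mult[OF tendsto_const[of 2] end_part_integral_tendsto_0[OF int_\<gamma>]]
        LIMSEQ_Suc[OF lim_1_over_n[where 'a = real]]]
    unfolding E_def by simp
  obtain K c where "c > 0" and bound: "\<And>x. \<forall>j. 0 < x $ j \<and> x $ j < 1 \<Longrightarrow>
      (\<forall>j. x $ j < c) \<or> (\<forall>j. 1 - c < x $ j) \<Longrightarrow> \<bar>\<psi> x\<bar> \<le> K * (1 + (\<Sum>j\<in>UNIV. \<bar>\<gamma> (x $ j)\<bar>))"
    using assms(7) unfolding \<psi>_def \<gamma>_def by blast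
  show ?thesis
    using range freq ends
  proof eventually_elim
    case (elim \<omega>)
    have lim: "(\<lambda>n. (\<Sum>i=1..n. \<psi> (\<chi> j. order_stat (\<lambda>k. U j k \<omega>) n i)) / real n) \<longlonglongrightarrow> (LBINT t:{0<..<1}. \<gamma> t)"
      unfolding \<gamma>_\<psi>
    proof (rule average_order_stats_tendsto[OF _ _ cont_\<psi> \<open>c > 0\<close> bound[unfolded \<gamma>_\<psi>] int_\<gamma>[unfolded \<gamma>_\<psi>]])
      show U01: "0 < U j k \<omega> \<and> U j k \<omega> < 1" if "1 \<le> k" for j k
        using elim(1) that by auto
      show "\<forall>\<^sub>F n in sequentially. \<forall>i\<in>{1..n}. \<bar>order_stat (\<lambda>k. U j k \<omega>) n i - real i / real n\<bar> < \<delta>"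
        if "\<delta> > 0" for j \<delta>
        by (rule order_stat_uniformly_near[OF U01 _ that]) (use elim(2) in auto)
      show "\<exists>\<epsilon>>0. \<forall>j. \<forall>\<^sub>F n in sequentially.
          (\<Sum>k=1..n. end_part (\<lambda>t. \<psi> (\<chi> j. t)) \<epsilon> (U j k \<omega>)) \<le> real n * \<eta>" if pos: "\<eta> > 0" for \<eta>
      proof -
        obtain m where m: "2 * E m + 1 / Suc m < \<eta>"
          using eventually_happens'[OF sequentially_bot order_tendstoD(2)[OF ends_vanish pos]] by blast
        show ?thesis
        proof (intro exI conjI allI)
          show "\<forall>\<^sub>F n in sequentially.
              (\<Sum>k=1..n. end_part (\<lambda>t. \<psi> (\<chi> j. t)) (1 / Suc m) (U j k \<omega>)) \<le> real n * \<eta>" for j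
            using elim(3)[rule_format, of m j] unfolding \<gamma>_\<psi>
          proof eventually_elim
            case (elim n)
            also have "real n * (2 * E m + 1 / Suc m) \<le> real n * \<eta>"
              using m by (intro mult_left_mono) auto
            finally show ?case .
          qed
        qed simp
      qed
    qed auto
    have pull_back: "\<psi> (\<chi> j. order_stat (\<lambda>k. U j k \<omega>) n i) = \<phi> (\<chi> j. order_stat (\<lambda>k. X k \<omega> $ j) n i)"
      if i: "i \<in> {1..n}" for n i
    proof -
      have "quantile (F j) (order_stat (\<lambda>k. U j k \<omega>) n i) = order_stat (\<lambda>k. X k \<omega> $ j) n i" for j
      proof -
        have eq: "order_stat (\<lambda>k. U j k \<omega>) n i = F j (order_stat (\<lambda>k. X k \<omega> $ j) n i)"
          unfolding U_def using i by (intro order_stat_mono_image mono_F) auto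
        obtain k where "k \<in> {1..n}" "order_stat (\<lambda>k. X k \<omega> $ j) n i = X k \<omega> $ j"
          using order_stat_in_sample[of i n "\<lambda>k. X k \<omega> $ j"] i by auto
        then show ?thesis
          using elim(1) unfolding eq by (auto simp: U_def)
      qed
      then show ?thesis by (simp add: \<psi>_def psi_def)
    qed
    have "(\<Sum>i=1..n. \<psi> (\<chi> j. order_stat (\<lambda>k. U j k \<omega>) n i)) =
        (\<Sum>i=1..n. \<phi> (\<chi> j. order_stat (\<lambda>k. X k \<omega> $ j) n i))" for n
      by (intro sum.cong refl pull_back)
    with lim value_\<gamma> show ?case by (simp add: \<gamma>_def)
  qed
qed

end
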